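(* Let $0<m\le L<\infty$ and let $r$ satisfy $\frac{\sqrt{L}-\sqrt{m}}{\sqrt{L}+\sqrt{m}}\le r<1$. Suppose the noise satisfies the noise assumption (with parameter $\sigma>0$). Then the three-parameter algorithm $\mathcal{A}=(\alpha,\beta,\eta)$ with $$\alpha=\tfrac1m(1-r)^2,\qquad \beta=r^2,\qquad \eta=0$$ achieves $$\mathrm{rate}(\mathcal{A},Q_{m,L})=r\qquad\text{and}\qquad \mathrm{sens}(\mathcal{A},Q_{m,L})=\frac1m\sqrt{\frac{1-r^4}{(1+r)^4}}.$$
   Context: Points of $\mathbb{R}^d$ are written as row vectors in $\mathbb{R}^{1\times d}$, $\nabla f:\mathbb{R}^{1\times d}\to\mathbb{R}^{1\times d}$, and $\|\cdot\|$ is the Frobenius norm. Function class $Q_{m,L}$: functions $f:\mathbb{R}^d\to\mathbb{R}$ such that for some $f^\star\in\mathbb{R}$, $y^\star\in\mathbb{R}^d$ and symmetric $Q\in\mathbb{R}^{d\times d}$ with all eigenvalues in $[m,L]$, $f(y)=\frac12(y-y^\star)Q(y-y^\star)^{\mathsf T}+f^\star$ ($y$ a row vector). $y^\star$ is the unique minimizer. Algorithms: $\mathcal{A}=(A,B,C)$ with $A\in\mathbb{R}^{n\times n}$, $B\in\mathbb{R}^{n\times1}$, $C\in\mathbb{R}^{1\times n}$ denotes the iteration $\xi^{t+1}=A\xi^t+B(u^t+w^t)$, $y^t=C\xi^t$, $u^t=\nabla f(y^t)$, where $\xi^t\in\mathbb{R}^{n\times d}$ is the state and $w^t\in\mathbb{R}^{1\times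 d}$ the noise. A fixed point $\xi^\star$ satisfies $\xi^\star=A\xi^\star$, $y^\star=C\xi^\star$. The three-parameter algorithm $(\alpha,\beta,\eta)$ is $x^{t+1}=x^t-\alpha\,g\bigl(x^t+\eta(x^t-x^{t-1})\bigr)+\beta(x^t-x^{t-1})$, where $g(x)=\nabla f(x)+w$ is the noisy gradient oracle ($w=w^t$ at iteration $t$); it is of the form $(A,B,C)$ with $n=2$, state $\xi^t=\begin{bmatrix}x^t\\ x^{t-1}\end{bmatrix}$, $A=\begin{bmatrix}1+\beta&-\beta\\ 1&0\end{bmatrix}$, $B=\begin{bmatrix}-\alpha\\ 0\end{bmatrix}$, $C=\begin{bmatrix}1+\eta&-\eta\end{bmatrix}$. Convergence rate (computed with $w^t=0$ for all $t$): for a function class $\mathcal{F}$, $$\mathrm{rate}(\mathcal{A},\mathcal{F})=\inf\Bigl\{r>0:\ \sup_{f\in\mathcal{F}}\sup_{\xi^0\in\mathbb{R}^{n\times d}}\sup_{t\ge0}\frac{\|\xi^t-\xi^\star\|}{r^t\|\xi^0-\xi^\star\|}<\infty\Bigr\}.$$ Noise assumption: the joint distribution $\mathbb{P}$ of $w^0,w^1,\dots$ lies in $\mathcal{P}_\sigma$, the set of all joint distributions for which the $w^t$ are independent across $t$ (not necessarily identically distributed), $\mathbb{E}\,w^t=0$, and $\mathbb{E}\|w^t\|^2\le\sigma^2$ for all $t$. Sensitivity: $$\mathrm{sens}(\mathcal{A},\mathcal{F})=\sup_{f\in\mathcal{F}}\sup_{\xi^0\in\mathbb{R}^{n\times d}}\sup_{\mathbb{P}\in\mathcal{P}_\sigma}\limsup_{T\to\infty}\sqrt{\mathbb{E}_{w\sim\mathbb{P}}\frac{1}{\sigma^2T}\sum_{t=0}^{T-1}\|y^t-y^\star\|^2}.$$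 *)

theory Defs
  imports "HOL-Probability.Probability"
begin

text \<open>
  A point of \<open>\<real>\<^sup>d\<close> is a row vector, that is, a \<open>1 \<times> d\<close> matrix of type \<open>real^'d^1\<close>. The norm
  and inner product of the library on \<open>real^'d^'n\<close> are the Frobenius norm and inner product.
\<close>

definition gradient :: "('a::real_inner \<Rightarrow> real) \<Rightarrow> 'a \<Rightarrow> 'a" where
  "gradient f y = (THE D. GDERIV f y :> D)"

definition minimizer :: "('a \<Rightarrow> real) \<Rightarrow> 'a" where
  "minimizer f = (ARG_MIN f y. True)"

definition is_eigenvalue :: "real^'d^'d \<Rightarrow> real \<Rightarrow> bool" where
  "is_eigenvalue Q c \<longleftrightarrow> (\<exists>v. v \<noteq> 0 \<and> Q *v v = c *\<^sub>R v)"

text \<open>Real eigenvalues suffice here since the matrices \<open>Q\<close> are real symmetric.\<close>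

definition quad_class :: "real \<Rightarrow> real \<Rightarrow> (real^'d^1 \<Rightarrow> real) set" where
  "quad_class m L = {f. \<exists>fstar ystar Q.
     transpose Q = Q \<and> (\<forall>c. is_eigenvalue Q c \<longrightarrow> c \<in> {m..L}) \<and>
     (\<forall>y. f y = 1/2 * ((y - ystar) ** Q ** transpose (y - ystar)) $ 1 $ 1 + fstar)}"

type_synonym 'n algorithm = "(real^'n^'n) \<times> (real^1^'n) \<times> (real^'n^1)"

primrec state ::
  "'n::finite algorithm \<Rightarrow> (real^'d^1 \<Rightarrow> real) \<Rightarrow> (nat \<Rightarrow> real^'d^1) \<Rightarrow> real^'d^'n \<Rightarrow> nat \<Rightarrow> real^'d^'n"
where
  "state \<A> f w \<xi>0 0 = \<xi>0"
| "state \<A> f w \<xi>0 (Suc t) = (case \<A> of (A, B, C) \<Rightarrow>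
     A ** state \<A> f w \<xi>0 t + B ** (gradient f (C ** state \<A> f w \<xi>0 t) + w t))"

definition alg_output ::
  "'n::finite algorithm \<Rightarrow> (real^'d^1 \<Rightarrow> real) \<Rightarrow> (nat \<Rightarrow> real^'d^1) \<Rightarrow> real^'d^'n \<Rightarrow> nat \<Rightarrow> real^'d^1"
where
  "alg_output \<A> f w \<xi>0 t = (case \<A> of (A, B, C) \<Rightarrow> C ** state \<A> f w \<xi>0 t)"

definition is_fixed_point ::
  "'n::finite algorithm \<Rightarrow> (real^'d^1 \<Rightarrow> real) \<Rightarrow> real^'d^'n \<Rightarrow> bool"
where
  "is_fixed_point \<A> f \<xi> \<longleftrightarrow> (case \<A> of (A, B, C) \<Rightarrow> \<xi> = A ** \<xi> \<and> minimizer f = C ** \<xi>)"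

definition fixed_point ::
  "'n::finite algorithm \<Rightarrow> (real^'d^1 \<Rightarrow> real) \<Rightarrow> real^'d^'n"
where
  "fixed_point \<A> f = (THE \<xi>. is_fixed_point \<A> f \<xi>)"

text \<open>
  When \<open>\<xi>0\<close> is itself the fixed point, the quotient below is \<open>0 / 0 = 0\<close>, so that this
  initial state does not influence the supremum.
\<close>

definition rate :: "'n::finite algorithm \<Rightarrow> (real^'d^1 \<Rightarrow> real) set \<Rightarrow> ennreal" where
  "rate \<A> F = (INF r \<in> {r::real. 0 < r \<and>
     (SUP f\<in>F. SUP \<xi>0. SUP t.
        ennreal (norm (state \<A> f (\<lambda>_. 0) \<xi>0 t - fixed_point \<A> f)
                 / (r ^ t * norm (\<xi>0 - fixed_point \<A> f)))) < \<infinity>}. ennreal r)"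

definition noise_laws :: "real \<Rightarrow> (nat \<Rightarrow> real^'d^1) measure set" where
  "noise_laws \<sigma> = {P. sets P = sets (\<Pi>\<^sub>M t\<in>UNIV. borel) \<and> prob_space P \<and>
     prob_space.indep_vars P (\<lambda>_. borel) (\<lambda>t w. w t) UNIV \<and>
     (\<forall>t. integrable P (\<lambda>w. w t) \<and> (\<integral>w. w t \<partial>P) = 0 \<and>
          (\<integral>\<^sup>+w. ennreal ((norm (w t))\<^sup>2) \<partial>P) \<le> ennreal (\<sigma>\<^sup>2))}"

definition sqrt_ennreal :: "ennreal \<Rightarrow> ennreal" where
  "sqrt_ennreal x = (if x = \<infinity> then \<infinity> else ennreal (sqrt (enn2real x)))"

definition sens :: "real \<Rightarrow> 'n::finite algorithm \<Rightarrow> (real^'d^1 \<Rightarrow> real) set \<Rightarrow> ennreal" where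
  "sens \<sigma> \<A> F = (SUP f\<in>F. SUP \<xi>0. SUP P\<in>noise_laws \<sigma>. limsup (\<lambda>T::nat. sqrt_ennreal
     (\<integral>\<^sup>+w. ennreal (1 / (\<sigma>\<^sup>2 * real T) *
               (\<Sum>t<T. (norm (alg_output \<A> f w \<xi>0 t - minimizer f))\<^sup>2)) \<partial>P)))"

definition three_param :: "real \<Rightarrow> real \<Rightarrow> real \<Rightarrow> 2 algorithm" where
  "three_param \<alpha> \<beta> \<eta> =
     (vector [vector [1 + \<beta>, - \<beta>], vector [1, 0]],
      vector [vector [- \<alpha>], vector [0]],
      vector [vector [1 + \<eta>, - \<eta>]])"

text \<open>
  The state \<open>stack x x'\<close> consists of the two rows \<open>x = x\<^sup>t\<close> and \<open>x' = x\<^sup>t\<^sup>-\<^sup>1\<close>. The next two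
  lemmas confirm that \<open>three_param\<close> is the usual three-parameter recursion, and that its fixed
  point exists and is unique.
\<close>

definition stack :: "real^'d^1 \<Rightarrow> real^'d^1 \<Rightarrow> real^'d^2" where
  "stack x x' = vector [x $ 1, x' $ 1]"

lemma three_param_step:
  assumes "state (three_param \<alpha> \<beta> \<eta>) f w \<xi>0 t = stack x x'"
  shows "state (three_param \<alpha> \<beta> \<eta>) f w \<xi>0 (Suc t) =
     stack (x - \<alpha> *\<^sub>R (gradient f (x + \<eta> *\<^sub>R (x - x')) + w t) + \<beta> *\<^sub>R (x - x')) x"
    and "alg_output (three_param \<alpha> \<beta> \<eta>) f w \<xi>0 t = x + \<eta> *\<^sub>R (x - x')"
proof -
  have *: "(vector [vector [1 + \<eta>, - \<eta>]] :: real^2^1) ** stack x x' = x + \<eta> *\<^sub>R (x - x')"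
    by (simp add: vec_eq_iff stack_def matrix_matrix_mult_def sum_2 vector_def forall_1 algebra_simps)
  show "alg_output (three_param \<alpha> \<beta> \<eta>) f w \<xi>0 t = x + \<eta> *\<^sub>R (x - x')"
    using assms * by (simp add: alg_output_def three_param_def)
  have "state (three_param \<alpha> \<beta> \<eta>) f w \<xi>0 (Suc t) =
     (vector [vector [1 + \<beta>, - \<beta>], vector [1, 0]] :: real^2^2) ** stack x x' +
     (vector [vector [- \<alpha>], vector [0]] :: real^1^2) ** (gradient f (x + \<eta> *\<^sub>R (x - x')) + w t)"
    using assms * by (simp add: three_param_def)
  also have "\<dots> = stack (x - \<alpha> *\<^sub>R (gradient f (x + \<eta> *\<^sub>R (x - x')) + w t) + \<beta> *\<^sub>R (x - x')) x"
    by (simp add: vec_eq_iff stack_def matrix_matrix_mult_def sum_2 forall_2 sum_1 vector_1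
        algebra_simps)
  finally show "state (three_param \<alpha> \<beta> \<eta>) f w \<xi>0 (Suc t) =
     stack (x - \<alpha> *\<^sub>R (gradient f (x + \<eta> *\<^sub>R (x - x')) + w t) + \<beta> *\<^sub>R (x - x')) x" .
qed

lemma is_fixed_point_three_param:
  "is_fixed_point (three_param \<alpha> \<beta> \<eta>) f \<xi> \<longleftrightarrow> \<xi> = stack (minimizer f) (minimizer f)"
  by (auto simp: is_fixed_point_def three_param_def vec_eq_iff stack_def matrix_matrix_mult_def
      sum_2 forall_2 forall_1 algebra_simps)

lemma fixed_point_three_param:
  "fixed_point (three_param \<alpha> \<beta> \<eta>) f = stack (minimizer f) (minimizer f)"
  by (simp add: fixed_point_def is_fixed_point_three_param)

end

theory Submission
  imports Defs
begin

text \<open>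
  For \<open>f\<close> quadratic with matrix \<open>Q\<close>, the errors \<open>x\<^sup>t - y\<^sup>\<star>\<close> follow the recursion
  \<open>x\<^sup>t\<^sup>+\<^sup>1 = G x\<^sup>t - r\<^sup>2 x\<^sup>t\<^sup>-\<^sup>1 - \<alpha> w\<^sup>t\<close> with the symmetric operator \<open>G = (1 + r\<^sup>2) I - \<alpha> Q\<close>, and the
  hypothesis on \<open>r\<close> ensures that \<open>G\<close> has norm at most \<open>2 r\<close>. Two quadratic forms then suffice, without
  diagonalizing \<open>Q\<close>: one is scaled by exactly \<open>r\<^sup>2\<close> in each noiseless step, which bounds
  the errors by a multiple of \<open>(1 + t) r\<^sup>t\<close> (if \<open>r > 0\<close>); the other decreases by a multiple of
  \<open>(1 + r\<^sup>2)\<^sup>2 \<bar>x\<^sup>t\<bar>\<^sup>2 - \<bar>G x\<^sup>t\<bar>\<^sup>2 \<ge> (1 - r\<^sup>2)\<^sup>2 \<bar>x\<^sup>t\<bar>\<^sup>2\<close> and increases by the noise power, up to terms of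
  mean zero, which bounds the sensitivity. Both bounds are attained for \<open>Q = m I\<close>, where \<open>G = 2 r I\<close>; for
  the sensitivity the noise is a random sign times a fixed vector of length \<open>\<sigma>\<close>.
\<close>

section \<open>Symmetric operators\<close>

text \<open>
  A unit vector \<open>v\<close> maximizing the norm of \<open>G v\<close> satisfies \<open>(G - l) (G + l) v = 0\<close> for
  \<open>l = norm (G v)\<close>, so that \<open>l\<close> or \<open>- l\<close> is an eigenvalue.
\<close>

lemma symmetric_norm_bound:
  fixes G :: "'a::euclidean_space \<Rightarrow> 'a"
  assumes lin: "linear G" and sym: "\<And>x y. G x \<bullet> y = x \<bullet> G y"
    and eig: "\<And>c v. v \<noteq> 0 \<Longrightarrow> G v = c *\<^sub>R v \<Longrightarrow> \<bar>c\<bar> \<le> B"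
  shows "norm (G x) \<le> B * norm x"
proof -
  interpret linear G by (rule lin)
  have cont: "continuous_on (sphere 0 1) (\<lambda>x. norm (G x))"
    by (intro continuous_intros linear_continuous_on linear_conv_bounded_linear[THEN iffD1] lin)
  obtain b :: 'a where b: "b \<in> Basis" using nonempty_Basis by blast
  then have "b \<in> sphere 0 1" by simp
  then obtain v where v: "norm v = 1" and max: "\<And>y. norm y = 1 \<Longrightarrow> norm (G y) \<le> norm (G v)"
    using continuous_attains_sup[OF compact_sphere _ cont] by fastforce
  define l where "l = norm (G v)"
  have bound: "norm (G y) \<le> l * norm y" for y
  proof (cases "y = 0")
    case True
    then show ?thesis by (simp add: zero)
  next
    case False
    then have "norm (G (y /\<^sub>R norm y)) \<le> l"
      unfolding l_def by (intro max) simp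
    with False show ?thesis by (simp add: scale field_simps)
  qed
  have "l \<ge> 0" by (simp add: l_def)
  have "norm (G (G v)) \<le> l * l" using bound[of "G v"] by (simp add: l_def)
  then have "(norm (G (G v)))\<^sup>2 \<le> (l * l)\<^sup>2" by (rule power_mono) simp
  moreover have "G (G v) \<bullet> v = l * l"
    using sym[of "G v" v] by (simp add: l_def flip: power2_norm_eq_inner power2_eq_square)
  moreover have "v \<bullet> v = 1" using v by (simp add: norm_eq_1)
  \<comment> \<open>Expanding the square gives at most l^4 - 2 l^4 + l^4 = 0, so the maximizer is an
    eigenvector of the square of \<open>G\<close>.\<close>
  ultimately have "(norm (G (G v) - (l * l) *\<^sub>R v))\<^sup>2 \<le> 0"
    by (simp add: power2_norm_eq_inner inner_diff_left inner_diff_right inner_commute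
        power2_eq_square[of "l * l"])
  then have GG: "G (G v) = (l * l) *\<^sub>R v" by simp
  have "l \<le> B"
  proof (cases "G v + l *\<^sub>R v = 0")
    case True
    then have "G v = (- l) *\<^sub>R v" by (simp add: eq_neg_iff_add_eq_0)
    moreover have "v \<noteq> 0" using v by auto
    ultimately have "\<bar>- l\<bar> \<le> B" by (intro eig)
    then show ?thesis by simp
  next
    case False
    have "G (G v + l *\<^sub>R v) = l *\<^sub>R (G v + l *\<^sub>R v)"
      by (simp add: add scale GG scaleR_add_right)
    then show ?thesis using eig[OF False, of l] by auto
  qed
  then show ?thesis
    using bound[of x] mult_right_mono[of l B "norm x"] by simp
qed

section \<open>The heavy-ball recursion\<close>

text \<open>The index runs one ahead of time: entry \<open>Suc t\<close> stands for the error of the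
  iterate at time t and entry 0 for that of the iterate before the start. Hence \<open>w t\<close>
  first enters at entry \<open>Suc (Suc t)\<close>.\<close>

fun traj :: "('a::real_vector \<Rightarrow> 'a) \<Rightarrow> real \<Rightarrow> real \<Rightarrow> 'a \<Rightarrow> 'a \<Rightarrow> (nat \<Rightarrow> 'a) \<Rightarrow> nat \<Rightarrow> 'a" where
  "traj G a b x0 x1 w 0 = x0"
| "traj G a b x0 x1 w (Suc 0) = x1"
| "traj G a b x0 x1 w (Suc (Suc t)) =
     G (traj G a b x0 x1 w (Suc t)) - b *\<^sub>R traj G a b x0 x1 w t - a *\<^sub>R w t"

text \<open>
  The form \<open>\<bar>x1\<bar>\<^sup>2 - x1 \<bullet> G x0 + r\<^sup>2 \<bar>x0\<bar>\<^sup>2\<close> is multiplied by \<open>r\<^sup>2\<close> in each noiseless step. Completing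
  the square shows that it dominates \<open>\<bar>x1 - G x0 / 2\<bar>\<^sup>2\<close>.
\<close>

lemma traj_step_le:
  fixes G :: "'a::real_inner \<Rightarrow> 'a" and a r :: real and x0 x1 :: 'a
  assumes sym: "\<And>x y. G x \<bullet> y = x \<bullet> G y"
    and bound: "\<And>x. norm (G x) \<le> 2 * r * norm x" and r: "0 \<le> r" "r < 1"
  defines "x \<equiv> traj G a (r\<^sup>2) x0 x1 (\<lambda>_. 0)"
  shows "norm (x (Suc t)) \<le> r * norm (x t) + r ^ t * (norm x0 + norm x1)"
proof -
  define W where "W t = x (Suc t) \<bullet> x (Suc t) - x (Suc t) \<bullet> G (x t) + r\<^sup>2 * (x t \<bullet> x t)" for t
  \<comment> \<open>The recursion turns the difference of entry t + 2 and \<open>G\<close> of entry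
    t + 1 into a multiple of entry t; symmetry then moves \<open>G\<close> back onto
    \<open>x t\<close>.\<close>
  have "W (Suc t) = r\<^sup>2 * W t" for t
    using sym[of "x (Suc t)" "x (Suc t)"] sym[of "x (Suc t)" "x t"]
    by (simp add: W_def x_def inner_diff_left inner_diff_right inner_commute algebra_simps)
  then have Wt: "W t = r ^ (2 * t) * W 0" for t
    by (induction t) (simp_all add: power2_eq_square)
  have "\<bar>x1 \<bullet> G x0\<bar> \<le> norm x1 * (2 * r * norm x0)"
    by (meson Cauchy_Schwarz_ineq2 bound mult_left_mono norm_ge_zero order_trans)
  also have "\<dots> \<le> norm x1 * (2 * norm x0)"
    using r by (intro mult_left_mono) (auto simp: mult_left_le_one_le)
  finally have "\<bar>x1 \<bullet> G x0\<bar> \<le> 2 * norm x0 * norm x1" by (simp add: mult_ac)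
  moreover have "r\<^sup>2 * (norm x0)\<^sup>2 \<le> (norm x0)\<^sup>2"
    using r by (intro mult_left_le_one_le) (auto simp: power_le_one)
  ultimately have W0: "W 0 \<le> (norm x0 + norm x1)\<^sup>2"
    by (simp add: W_def x_def power2_sum flip: power2_norm_eq_inner)
  have "(norm (x (Suc t) - (1/2) *\<^sub>R G (x t)))\<^sup>2 = W t - (r\<^sup>2 * (norm (x t))\<^sup>2 - (norm (G (x t)))\<^sup>2 / 4)"
    by (simp add: W_def power2_norm_eq_inner inner_diff_left inner_diff_right inner_commute)
  also have "(norm (G (x t)))\<^sup>2 \<le> (2 * r * norm (x t))\<^sup>2"
    by (rule power_mono) (auto simp: bound)
  then have "W t - (r\<^sup>2 * (norm (x t))\<^sup>2 - (norm (G (x t)))\<^sup>2 / 4) \<le> W t"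
    by (simp add: power_mult_distrib)
  also have "W t \<le> r ^ (2 * t) * (norm x0 + norm x1)\<^sup>2"
    unfolding Wt[of t] by (rule mult_left_mono[OF W0]) (use r in simp)
  also have "\<dots> = (r ^ t * (norm x0 + norm x1))\<^sup>2"
    by (simp add: power_mult_distrib mult.commute flip: power_mult)
  finally have "norm (x (Suc t) - (1/2) *\<^sub>R G (x t)) \<le> r ^ t * (norm x0 + norm x1)"
    by (rule power2_le_imp_le) (use r in simp)
  moreover have "norm ((1/2) *\<^sub>R G (x t)) \<le> r * norm (x t)"
    using bound[of "x t"] by simp
  ultimately show ?thesis
    using norm_triangle_sub[of "x (Suc t)" "(1/2) *\<^sub>R G (x t)"] by linarith
qed

text \<open>Unrolling \<open>traj_step_le\<close> leaves a term of order t r^(t-1), the trace of a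
  double root. Any \<rho> above r absorbs the factor t.\<close>

lemma traj_geometric_bound:
  fixes G :: "'a::real_inner \<Rightarrow> 'a"
  assumes sym: "\<And>x y. G x \<bullet> y = x \<bullet> G y"
    and bound: "\<And>x. norm (G x) \<le> 2 * r * norm x" and r: "0 \<le> r" "r < 1" "r < \<rho>"
  shows "norm (traj G a (r\<^sup>2) x0 x1 (\<lambda>_. 0) t) \<le> (1 + 1 / (\<rho> - r)) * \<rho> ^ t * (norm x0 + norm x1)"
proof (induction t)
  case 0
  have "norm x0 \<le> 1 * (norm x0 + norm x1)" by simp
  also have "\<dots> \<le> (1 + 1 / (\<rho> - r)) * (norm x0 + norm x1)"
    using r by (intro mult_right_mono) auto
  finally show ?case by simp
next
  case (Suc t)
  define N where "N = norm x0 + norm x1"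
  \<comment> \<open>The summand 1 serves the base case; the other one pays for the inhomogeneous
    term, in the form \<open>r * D + 1 \<le> \<rho> * D\<close>.\<close>
  define D where "D = 1 + 1 / (\<rho> - r)"
  have "N \<ge> 0" by (simp add: N_def)
  have "(\<rho> - r) * D = \<rho> - r + 1" using r by (simp add: D_def distrib_left)
  then have D: "r * D + 1 \<le> \<rho> * D" using r by (simp add: left_diff_distrib)
  have "norm (traj G a (r\<^sup>2) x0 x1 (\<lambda>_. 0) (Suc t)) \<le> r * norm (traj G a (r\<^sup>2) x0 x1 (\<lambda>_. 0) t) + r ^ t * N"
    unfolding N_def using sym bound r(1,2) by (rule traj_step_le)
  also have "\<dots> \<le> r * (D * \<rho> ^ t * N) + \<rho> ^ t * N"
    using Suc r \<open>N \<ge> 0\<close> by (intro add_mono mult_left_mono mult_right_mono power_mono) (auto simp: N_def D_def)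
  also have "\<dots> = (r * D + 1) * (\<rho> ^ t * N)" by (simp add: algebra_simps)
  also have "\<dots> \<le> \<rho> * D * (\<rho> ^ t * N)"
    using r \<open>N \<ge> 0\<close> by (intro mult_right_mono D) auto
  finally show ?case by (simp add: N_def D_def mult_ac)
qed

section \<open>The energy form and sums of squared iterates\<close>

definition energy :: "('a::real_inner \<Rightarrow> 'a) \<Rightarrow> real \<Rightarrow> 'a \<Rightarrow> 'a \<Rightarrow> real" where
  "energy G b x0 x1 = (1 + b) * (x1 \<bullet> x1) - 2 * b * (x1 \<bullet> G x0) + b\<^sup>2 * (1 + b) * (x0 \<bullet> x0)"

text \<open>
  On an eigenvector of \<open>G\<close> with eigenvalue \<open>g\<close>, the energy is the observability Gramian multiplied by
  \<open>(1 - b) * ((1 + b)\<^sup>2 - g\<^sup>2)\<close>; this factor makes it polynomial in \<open>g\<close>.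
\<close>

lemma energy_balance:
  fixes G :: "'a::real_inner \<Rightarrow> 'a" and a b :: real and x0 x1 :: 'a
  assumes sym: "\<And>x y. G x \<bullet> y = x \<bullet> G y"
  defines "x \<equiv> traj G a b x0 x1"
  shows "energy G b (x w T) (x w (Suc T)) +
      (1 - b) * (\<Sum>t<T. (1 + b)\<^sup>2 * (norm (x w (Suc t)))\<^sup>2 - (norm (G (x w (Suc t))))\<^sup>2) =
    energy G b x0 x1 + a\<^sup>2 * (1 + b) * (\<Sum>t<T. (norm (w t))\<^sup>2)
      - 2 * a * (\<Sum>t<T. w t \<bullet> (G (x w (Suc t)) - (b * (1 + b)) *\<^sub>R x w t))"
proof (induction T)
  case 0
  show ?case by (simp add: x_def)
next
  case (Suc T)
  \<comment> \<open>By symmetry the mixed term in \<open>G y\<close> and \<open>z\<close> becomes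
    exactly the one in \<open>energy G b z y\<close>; besides the noise terms only the squares of
    \<open>y\<close> and \<open>G y\<close> remain.\<close>
  have step: "energy G b y (G y - b *\<^sub>R z - a *\<^sub>R v) = energy G b z y
      - (1 - b) * ((1 + b)\<^sup>2 * (norm y)\<^sup>2 - (norm (G y))\<^sup>2)
      + a\<^sup>2 * (1 + b) * (norm v)\<^sup>2 - 2 * a * (v \<bullet> (G y - (b * (1 + b)) *\<^sub>R z))" for y z v
    using sym[of y z]
    by (simp add: energy_def inner_diff_left inner_diff_right inner_commute power2_norm_eq_inner
        power2_eq_square[of a] power2_eq_square[of b] power2_eq_square[of "1 + b"] algebra_simps)
  have "energy G b (x w (Suc T)) (x w (Suc (Suc T))) = energy G b (x w T) (x w (Suc T))
      - (1 - b) * ((1 + b)\<^sup>2 * (norm (x w (Suc T)))\<^sup>2 - (norm (G (x w (Suc T))))\<^sup>2)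
      + a\<^sup>2 * (1 + b) * (norm (w T))\<^sup>2
      - 2 * a * (w T \<bullet> (G (x w (Suc T)) - (b * (1 + b)) *\<^sub>R x w T))"
    using step[of "x w (Suc T)" "x w T" "w T"] by (simp add: x_def)
  with Suc.IH show ?case
    by (simp only: sum.lessThan_Suc distrib_left)
qed

text \<open>Since 2 r is at most 1 + r^2, the mixed term is at most (1 + r^2) times 2 u (r^2 v),
  which the two square terms dominate. This permits dropping the final energy in upper
  bounds.\<close>

lemma energy_nonneg:
  fixes G :: "'a::real_inner \<Rightarrow> 'a"
  assumes bound: "\<And>x. norm (G x) \<le> 2 * r * norm x" and r: "0 \<le> r"
  shows "0 \<le> energy G (r\<^sup>2) x0 x1"
proof -
  define u v where "u = norm x1" and "v = norm x0"
  have uv: "0 \<le> u" "0 \<le> v" by (simp_all add: u_def v_def)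
  have "\<bar>x1 \<bullet> G x0\<bar> \<le> u * (2 * r * v)"
    unfolding u_def v_def by (meson Cauchy_Schwarz_ineq2 bound mult_left_mono norm_ge_zero order_trans)
  then have "2 * r\<^sup>2 * (x1 \<bullet> G x0) \<le> 2 * r\<^sup>2 * (u * (2 * r * v))"
    by (intro mult_left_mono) auto
  moreover have "4 * r * (u * (r\<^sup>2 * v)) \<le> 2 * (1 + r\<^sup>2) * (u * (r\<^sup>2 * v))"
    using uv zero_le_power2[of "1 - r"]
    by (intro mult_right_mono) (auto simp: power2_diff)
  moreover have "(1 + r\<^sup>2) * (u\<^sup>2 + (r\<^sup>2 * v)\<^sup>2) \<ge> (1 + r\<^sup>2) * (2 * u * (r\<^sup>2 * v))"
    by (intro mult_left_mono sum_squares_bound) auto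
  ultimately have "0 \<le> (1 + r\<^sup>2) * u\<^sup>2 - 2 * r\<^sup>2 * (x1 \<bullet> G x0) + (r\<^sup>2)\<^sup>2 * (1 + r\<^sup>2) * v\<^sup>2"
    by (simp add: algebra_simps power2_eq_square)
  then show ?thesis by (simp add: energy_def u_def v_def power2_norm_eq_inner)
qed

text \<open>The energy balance with the final energy dropped. The norm bound on \<open>G\<close>
  costs 4 b, and (1 + b)^2 - 4 b = (1 - b)^2; with the factor 1 - b of the balance this gives the
  cube.\<close>

lemma traj_output_sum_le:
  fixes G :: "'a::real_inner \<Rightarrow> 'a" and a r :: real and x0 x1 :: 'a
  assumes sym: "\<And>x y. G x \<bullet> y = x \<bullet> G y"
    and bound: "\<And>x. norm (G x) \<le> 2 * r * norm x" and r: "0 \<le> r" "r < 1"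
  defines "b \<equiv> r\<^sup>2"
  defines "x \<equiv> traj G a b x0 x1"
  shows "(1 - b) ^ 3 * (\<Sum>t<T. (norm (x w (Suc t)))\<^sup>2) \<le>
    energy G b x0 x1 + a\<^sup>2 * (1 + b) * (\<Sum>t<T. (norm (w t))\<^sup>2)
      - 2 * a * (\<Sum>t<T. w t \<bullet> (G (x w (Suc t)) - (b * (1 + b)) *\<^sub>R x w t))"
proof -
  have "(1 - b)\<^sup>2 * (norm y)\<^sup>2 \<le> (1 + b)\<^sup>2 * (norm y)\<^sup>2 - (norm (G y))\<^sup>2" for y
  proof -
    have "(norm (G y))\<^sup>2 \<le> (2 * r * norm y)\<^sup>2"
      by (rule power_mono) (auto simp: bound)
    then show ?thesis
      by (simp add: b_def power2_sum power2_diff power_mult_distrib algebra_simps)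
  qed
  then have "(1 - b) * (\<Sum>t<T. (1 - b)\<^sup>2 * (norm (x w (Suc t)))\<^sup>2) \<le>
      (1 - b) * (\<Sum>t<T. (1 + b)\<^sup>2 * (norm (x w (Suc t)))\<^sup>2 - (norm (G (x w (Suc t))))\<^sup>2)"
    using r by (intro mult_left_mono sum_mono) (auto simp: b_def power_le_one)
  moreover have "(1 - b) * (\<Sum>t<T. (1 - b)\<^sup>2 * (norm (x w (Suc t)))\<^sup>2) =
      (1 - b) ^ 3 * (\<Sum>t<T. (norm (x w (Suc t)))\<^sup>2)"
    by (simp add: sum_distrib_left power3_eq_cube power2_eq_square mult.assoc)
  moreover have "0 \<le> energy G b (x w T) (x w (Suc T))"
    unfolding b_def using bound r(1) by (rule energy_nonneg)
  ultimately show ?thesis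
    using energy_balance[OF sym, of b a x0 x1 w T] by (simp add: x_def)
qed

text \<open>Both characteristic roots equal r, so the recursion splits into two first-order ones,
  for \<open>x (Suc t) - r *\<^sub>R x t\<close> and for \<open>x t\<close>. Each contributes a
  factor 1 / (1 - r).\<close>

lemma scalar_traj_bounded:
  fixes w :: "nat \<Rightarrow> 'a::real_inner" and a r :: real
  assumes r: "0 \<le> r" "r < 1" and w: "\<And>t. norm (w t) \<le> K"
  defines "x \<equiv> traj (\<lambda>v. (2 * r) *\<^sub>R v) a (r\<^sup>2) 0 0 w"
  shows "norm (x t) \<le> \<bar>a\<bar> * K / (1 - r)\<^sup>2"
proof -
  have K: "K \<ge> 0" by (rule order_trans[OF norm_ge_zero w[of 0]])
  define B where "B = \<bar>a\<bar> * K / (1 - r)"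
  define D where "D = B / (1 - r)"
  have "(1 - r) * B = \<bar>a\<bar> * K" "(1 - r) * D = B" "B \<ge> 0" "D \<ge> 0"
    using r K by (simp_all add: B_def D_def)
  then have B: "B \<ge> 0" "r * B + \<bar>a\<bar> * K = B" "r * D + B = D" "D \<ge> 0"
    by (simp_all add: left_diff_distrib)
  have "norm (x (Suc t) - r *\<^sub>R x t) \<le> B \<and> norm (x t) \<le> D" for t
  proof (induction t)
    case 0
    show ?case using B by (simp add: x_def)
  next
    case (Suc t)
    have "x (Suc (Suc t)) - r *\<^sub>R x (Suc t) = r *\<^sub>R (x (Suc t) - r *\<^sub>R x t) - a *\<^sub>R w t"
      by (simp add: x_def algebra_simps power2_eq_square flip: scaleR_left_distrib)
    also have "norm \<dots> \<le> r * norm (x (Suc t) - r *\<^sub>R x t) + \<bar>a\<bar> * norm (w t)"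
      using r norm_triangle_ineq4[of "r *\<^sub>R (x (Suc t) - r *\<^sub>R x t)" "a *\<^sub>R w t"] by simp
    also have "\<dots> \<le> r * B + \<bar>a\<bar> * K"
      using Suc r w by (intro add_mono mult_left_mono) auto
    finally have 1: "norm (x (Suc (Suc t)) - r *\<^sub>R x (Suc t)) \<le> B" using B by simp
    have "norm (x (Suc t)) \<le> norm (r *\<^sub>R x t) + norm (x (Suc t) - r *\<^sub>R x t)"
      by (rule norm_triangle_sub)
    also have "\<dots> \<le> r * (D) + B"
      using Suc r by (intro add_mono) (auto intro: mult_left_mono)
    finally show ?case using 1 B by simp
  qed
  then show ?thesis by (simp add: D_def B_def power2_eq_square)
qed

text \<open>For G = 2 r I the comparison in \<open>traj_output_sum_le\<close> is an equality and the
  start at 0 has no energy. The only loss is the final energy, which stays bounded uniformly in T by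
  \<open>scalar_traj_bounded\<close>.\<close>

lemma scalar_traj_output_sum_ge:
  fixes w :: "nat \<Rightarrow> 'a::real_inner" and a r :: real
  assumes r: "0 \<le> r" "r < 1" and w: "\<And>t. norm (w t) = \<sigma>"
  defines "b \<equiv> r\<^sup>2"
  defines "x \<equiv> traj (\<lambda>v. (2 * r) *\<^sub>R v) a b 0 0"
  shows "a\<^sup>2 * (1 + b) * \<sigma>\<^sup>2 * real T - 8 * (\<bar>a\<bar> * \<sigma> / (1 - r)\<^sup>2)\<^sup>2
      - 2 * a * (\<Sum>t<T. w t \<bullet> ((2 * r) *\<^sub>R x w (Suc t) - (b * (1 + b)) *\<^sub>R x w t))
    \<le> (1 - b) ^ 3 * (\<Sum>t<T. (norm (x w (Suc t)))\<^sup>2)"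
proof -
  let ?G = "\<lambda>v::'a. (2 * r) *\<^sub>R v"
  define C where "C = \<bar>a\<bar> * \<sigma> / (1 - r)\<^sup>2"
  have C: "norm (x w t) \<le> C" for t
    unfolding x_def b_def C_def by (rule scalar_traj_bounded) (simp_all add: r w)
  have sq: "x w t \<bullet> x w t \<le> C\<^sup>2" for t
    using power_mono[OF C[of t], of 2] by (simp add: power2_norm_eq_inner)
  have C0: "C \<ge> 0" by (rule order_trans[OF norm_ge_zero C[of 0]])
  have b: "0 \<le> b" "b \<le> 1" using r by (auto simp: b_def power_le_one)
  have cross: "\<bar>x w (Suc T) \<bullet> x w T\<bar> \<le> C\<^sup>2"
    using mult_mono[OF C[of "Suc T"] C[of T] C0] Cauchy_Schwarz_ineq2[of "x w (Suc T)" "x w T"]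
    by (simp add: power2_eq_square)
  \<comment> \<open>The constant is 8 = 2 + 2 + 4, from the two square terms and the mixed term,
    using that b and r are at most 1.\<close>
  have E: "energy ?G b (x w T) (x w (Suc T)) \<le> 8 * C\<^sup>2"
  proof -
    have "(1 + b) * (x w (Suc T) \<bullet> x w (Suc T)) \<le> 2 * C\<^sup>2"
      using mult_mono[OF _ sq, of "1 + b" 2] b by simp
    moreover have "(b\<^sup>2 * (1 + b)) * (x w T \<bullet> x w T) \<le> 2 * C\<^sup>2"
      using mult_mono[OF _ sq, of "b\<^sup>2 * (1 + b)" 2] mult_mono[of "b\<^sup>2" 1 "1 + b" 2] b
      by (simp add: power_le_one)
    moreover have "(4 * (b * r)) * \<bar>x w (Suc T) \<bullet> x w T\<bar> \<le> 4 * C\<^sup>2"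
      using mult_mono[OF _ cross, of "4 * (b * r)" 4] mult_le_one[of b r] b r by simp
    moreover have "(4 * (b * r)) * (- (x w (Suc T) \<bullet> x w T)) \<le> (4 * (b * r)) * \<bar>x w (Suc T) \<bullet> x w T\<bar>"
      by (rule mult_left_mono[OF abs_ge_minus_self]) (use b r in simp)
    ultimately show ?thesis by (simp add: energy_def mult.assoc)
  qed
  have K: "(1 + b)\<^sup>2 * (norm y)\<^sup>2 - (norm (?G y))\<^sup>2 = (1 - b)\<^sup>2 * (norm y)\<^sup>2" for y :: 'a
    using r by (simp add: b_def power2_sum power2_diff power_mult_distrib algebra_simps)
  have 1: "(1 - b) * (\<Sum>t<T. (1 - b)\<^sup>2 * (norm (x w (Suc t)))\<^sup>2) =
      (1 - b) ^ 3 * (\<Sum>t<T. (norm (x w (Suc t)))\<^sup>2)"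
    by (simp add: sum_distrib_left power3_eq_cube power2_eq_square mult.assoc)
  have 2: "energy ?G b 0 0 = 0" by (simp add: energy_def)
  have 3: "a\<^sup>2 * (1 + b) * (\<Sum>t<T. (norm (w t))\<^sup>2) = a\<^sup>2 * (1 + b) * \<sigma>\<^sup>2 * real T"
    by (simp add: w)
  have bal: "energy ?G b (x w T) (x w (Suc T)) +
      (1 - b) * (\<Sum>t<T. (1 + b)\<^sup>2 * (norm (x w (Suc t)))\<^sup>2 - (norm (?G (x w (Suc t))))\<^sup>2) =
    energy ?G b 0 0 + a\<^sup>2 * (1 + b) * (\<Sum>t<T. (norm (w t))\<^sup>2)
      - 2 * a * (\<Sum>t<T. w t \<bullet> (?G (x w (Suc t)) - (b * (1 + b)) *\<^sub>R x w t))"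
    unfolding x_def by (rule energy_balance) simp
  show ?thesis
    using bal[unfolded K 1 2 3] E unfolding C_def[symmetric] by linarith
qed


section \<open>Quadratic functions\<close>

lemma row_mult_component: "(y ** Q) $ 1 = (y :: real^'d^1) $ 1 v* Q"
  by (simp add: vec_eq_iff matrix_matrix_mult_def vector_matrix_mult_def mult.commute)

lemma inner_row: "x \<bullet> y = x $ 1 \<bullet> (y :: real^'d^1) $ 1"
  by (simp add: inner_vec_def)

lemma quadratic_form_eq_inner: "(y ** Q ** transpose y) $ 1 $ 1 = (y ** Q) \<bullet> (y :: real^'d^1)"
  by (simp add: inner_row) (simp add: matrix_matrix_mult_def inner_vec_def transpose_def)

lemma row_mult_symmetric:
  assumes "transpose Q = Q"
  shows "(x ** Q) \<bullet> y = x \<bullet> ((y :: real^'d^1) ** Q)"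
proof -
  have "Q *v v = v v* Q" for v using assms by (metis transpose_matrix_vector)
  then show ?thesis by (simp add: inner_row row_mult_component dot_lmul_matrix)
qed

lemma linear_row_mult: "linear (\<lambda>v::real^'d^1. v ** Q)"
  by (rule linearI) (simp_all add: matrix_add_ldistrib scalar_matrix_assoc matrix_matrix_mult_def vec_eq_iff sum.distrib distrib_right sum_distrib_left mult.assoc)

text \<open>Symmetry of \<open>Q\<close> merges the two terms of the product rule and cancels the
  factor 1/2. Uniqueness is shown as well because \<open>gradient\<close> is a definite
  description.\<close>

lemma gradient_quadratic:
  fixes f :: "real^'d^1 \<Rightarrow> real"
  assumes sym: "transpose Q = Q"
    and f: "\<And>y. f y = 1/2 * ((y - ystar) ** Q ** transpose (y - ystar)) $ 1 $ 1 + fstar"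
  shows "gradient f y = (y - ystar) ** Q"
proof -
  have "bounded_linear (\<lambda>v::real^'d^1. v ** Q)"
    using linear_row_mult by (rule linear_conv_bounded_linear[THEN iffD1])
  then have "((\<lambda>y. (y - ystar) ** Q) has_derivative (\<lambda>h. h ** Q)) (at y)"
    by (rule bounded_linear.has_derivative) (auto intro!: derivative_eq_intros)
  then have "((\<lambda>y. 1/2 * (((y - ystar) ** Q) \<bullet> (y - ystar)) + fstar) has_derivative
      (\<lambda>h. h \<bullet> ((y - ystar) ** Q))) (at y)"
    by (auto intro!: derivative_eq_intros simp: row_mult_symmetric[OF sym] inner_commute)
  then have "GDERIV f y :> (y - ystar) ** Q"
    unfolding gderiv_def f quadratic_form_eq_inner .
  moreover have "D = (y - ystar) ** Q" if "GDERIV f y :> D" for D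
  proof -
    have "(\<lambda>h. h \<bullet> D) = (\<lambda>h. h \<bullet> ((y - ystar) ** Q))"
      using that \<open>GDERIV f y :> (y - ystar) ** Q\<close> unfolding gderiv_def by (rule has_derivative_unique)
    then show ?thesis by (metis inner_commute vector_eq_ldot)
  qed
  ultimately show ?thesis unfolding gradient_def by (rule the_equality)
qed

text \<open>An eigenvalue c of \<open>G\<close> comes from the eigenvalue (1 + r^2 - c) / \<alpha>
  of \<open>Q\<close>. The step size gives \<alpha> m = (1 - r)^2, and the lower bound on r amounts
  to \<alpha> L \<le> (1 + r)^2; together they confine c to [-2 r, 2 r].\<close>

lemma quadratic_heavy_ball_operator:
  fixes f :: "real^'d^1 \<Rightarrow> real"
  assumes m: "0 < m" "m \<le> L"
    and r: "(sqrt L - sqrt m) / (sqrt L + sqrt m) \<le> r" "r < 1"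
    and sym: "transpose Q = Q" and eig: "\<forall>c. is_eigenvalue Q c \<longrightarrow> c \<in> {m..L}"
    and f: "\<And>y. f y = 1/2 * ((y - ystar) ** Q ** transpose (y - ystar)) $ 1 $ 1 + fstar"
  defines "\<alpha> \<equiv> 1 / m * (1 - r)\<^sup>2"
  defines "G \<equiv> \<lambda>v::real^'d^1. (1 + r\<^sup>2) *\<^sub>R v - \<alpha> *\<^sub>R (v ** Q)"
  shows "linear G" and "\<And>x y. G x \<bullet> y = x \<bullet> G y" and "\<And>v. norm (G v) \<le> 2 * r * norm v"
    and "minimizer f = ystar"
    and "\<And>y. \<alpha> *\<^sub>R gradient f y = (1 + r\<^sup>2) *\<^sub>R (y - ystar) - G (y - ystar)"
proof -
  have \<alpha>: "0 < \<alpha>" using m r by (simp add: \<alpha>_def)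
  show lin: "linear G"
    unfolding G_def by (intro linear_compose_sub linear_compose_scale_right linear_row_mult linear_ident)
  show symG: "G x \<bullet> y = x \<bullet> G y" for x y
    by (simp add: G_def inner_diff_left inner_diff_right row_mult_symmetric[OF sym])
  have L: "(1 - r)\<^sup>2 * L \<le> (1 + r)\<^sup>2 * m"
  proof -
    have "sqrt L - sqrt m \<le> r * (sqrt L + sqrt m)"
      using r m by (simp add: pos_divide_le_eq add_pos_pos)
    then have "(1 - r) * sqrt L \<le> (1 + r) * sqrt m" by (simp add: algebra_simps)
    then have "((1 - r) * sqrt L)\<^sup>2 \<le> ((1 + r) * sqrt m)\<^sup>2"
      using r m by (intro power_mono) auto
    then show ?thesis using m by (simp add: power_mult_distrib)
  qed
  show bound: "norm (G v) \<le> 2 * r * norm v" for v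
  proof (rule symmetric_norm_bound[OF lin symG])
    fix c and v :: "real^'d^1"
    assume v: "v \<noteq> 0" and "G v = c *\<^sub>R v"
    then have "\<alpha> *\<^sub>R (v ** Q) = (1 + r\<^sup>2 - c) *\<^sub>R v"
      by (simp add: G_def algebra_simps)
    then have "(1 / \<alpha>) *\<^sub>R (\<alpha> *\<^sub>R (v ** Q)) = ((1 + r\<^sup>2 - c) / \<alpha>) *\<^sub>R v" by simp
    then have "v ** Q = ((1 + r\<^sup>2 - c) / \<alpha>) *\<^sub>R v" using \<alpha> by simp
    then have "v $ 1 v* Q = ((1 + r\<^sup>2 - c) / \<alpha>) *\<^sub>R v $ 1"
      by (simp flip: row_mult_component)
    \<comment> \<open>\<open>is_eigenvalue\<close> speaks of columns, whereas \<open>Q\<close> acts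
      on rows from the right here; its symmetry reconciles the two.\<close>
    then have "Q *v (v $ 1) = ((1 + r\<^sup>2 - c) / \<alpha>) *\<^sub>R v $ 1"
      using sym by (metis transpose_matrix_vector)
    moreover have "v $ 1 \<noteq> 0" using v by (auto simp: vec_eq_iff forall_1)
    ultimately have "(1 + r\<^sup>2 - c) / \<alpha> \<in> {m..L}"
      by (intro eig[rule_format]) (auto simp: is_eigenvalue_def)
    then have "\<alpha> * m \<le> 1 + r\<^sup>2 - c" "1 + r\<^sup>2 - c \<le> \<alpha> * L"
      using \<alpha> by (auto simp: pos_le_divide_eq pos_divide_le_eq mult.commute)
    moreover have "\<alpha> * m = (1 - r)\<^sup>2" using m by (simp add: \<alpha>_def)
    moreover have "\<alpha> * L \<le> (1 + r)\<^sup>2" using L m by (simp add: \<alpha>_def pos_divide_le_eq)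
    ultimately show "\<bar>c\<bar> \<le> 2 * r" by (simp add: power2_diff power2_sum)
  qed
  have grad: "gradient f y = (y - ystar) ** Q" for y
    by (rule gradient_quadratic[OF sym f])
  then show "\<alpha> *\<^sub>R gradient f y = (1 + r\<^sup>2) *\<^sub>R (y - ystar) - G (y - ystar)" for y
    by (simp add: G_def)
  \<comment> \<open>Positive definiteness follows from the norm bound instead of a second look at
    eigenvalues: \<alpha> Q = (1 + r^2) I - G is at least (1 + r^2 - 2 r) I = (1 - r)^2 I.\<close>
  have pos: "0 < (v ** Q) \<bullet> v" if "v \<noteq> 0" for v :: "real^'d^1"
  proof -
    have "G v \<bullet> v \<le> norm (G v) * norm v" by (rule norm_cauchy_schwarz)
    also have "\<dots> \<le> 2 * r * norm v * norm v" by (intro mult_right_mono bound) simp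
    also have "\<dots> = 2 * r * (v \<bullet> v)" by (simp add: dot_square_norm power2_eq_square)
    finally have "(1 - r)\<^sup>2 * (v \<bullet> v) \<le> \<alpha> * ((v ** Q) \<bullet> v)"
      by (simp add: G_def inner_diff_left power2_diff left_diff_distrib distrib_right)
    moreover have "0 < (1 - r)\<^sup>2 * (v \<bullet> v)" using that r by simp
    ultimately have "0 < \<alpha> * ((v ** Q) \<bullet> v)" by linarith
    then show ?thesis using \<alpha> by (simp add: zero_less_mult_iff)
  qed
  have less: "f ystar < f y" if "y \<noteq> ystar" for y
    using pos[of "y - ystar"] that linear_0[OF linear_row_mult, of Q]
    by (simp add: f quadratic_form_eq_inner)
  show "minimizer f = ystar"
    unfolding minimizer_def arg_min_def
  proof (rule some_equality)
    show "is_arg_min f (\<lambda>_. True) ystar"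
      using less by (auto simp: is_arg_min_def) (metis less_asym less_irrefl)
    show "y = ystar" if "is_arg_min f (\<lambda>_. True) y" for y
      using less that by (auto simp: is_arg_min_def)
  qed
qed

text \<open>The extremal function. The terms \<open>y - 0\<close> and \<open>+ 0\<close> keep it
  literally in the shape demanded by \<open>quad_class\<close> and by
  \<open>quadratic_heavy_ball_operator\<close>.\<close>

lemma scalar_quadratic_in_quad_class:
  assumes "m \<le> L"
  shows "(\<lambda>y::real^'d^1. 1/2 * ((y - 0) ** mat m ** transpose (y - 0)) $ 1 $ 1 + 0) \<in> quad_class m L"
  and "\<forall>c. is_eigenvalue (mat m :: real^'d^'d) c \<longrightarrow> c \<in> {m..L}"
  and "(v :: real^'d^1) ** mat m = m *\<^sub>R v"
proof -
  have mat: "(mat m :: real^'d^'d) *v u = m *\<^sub>R u" for u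
    by (simp flip: matrix_scaleR)
  then show eig: "\<forall>c. is_eigenvalue (mat m :: real^'d^'d) c \<longrightarrow> c \<in> {m..L}"
    using assms by (auto simp: is_eigenvalue_def)
  have "u v* mat m = m *\<^sub>R u" for u :: "real^'d"
    using mat[of u] by (simp flip: transpose_matrix_vector)
  then show "v ** mat m = m *\<^sub>R v"
    by (simp add: vec_eq_iff forall_1 row_mult_component)
  show "(\<lambda>y::real^'d^1. 1/2 * ((y - 0) ** mat m ** transpose (y - 0)) $ 1 $ 1 + 0) \<in> quad_class m L"
    unfolding quad_class_def using eig by (intro CollectI exI[of _ 0] exI[of _ "mat m"]) simp
qed

section \<open>Noise\<close>

lemma noise_lawsD:
  fixes P :: "(nat \<Rightarrow> real^'d^1) measure"
  assumes "P \<in> noise_laws \<sigma>"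
  shows "prob_space P" and "(\<lambda>w. w t) \<in> borel_measurable P" and "integrable P (\<lambda>w. w t)"
    and "(\<integral>w. w t \<partial>P) = 0"
    and "integrable P (\<lambda>w. (norm (w t))\<^sup>2)" and "(\<integral>w. (norm (w t))\<^sup>2 \<partial>P) \<le> \<sigma>\<^sup>2"
proof -
  show "prob_space P" "(\<integral>w. w t \<partial>P) = 0" and int: "integrable P (\<lambda>w. w t)"
    using assms by (auto simp: noise_laws_def)
  from int show meas[measurable]: "(\<lambda>w. w t) \<in> borel_measurable P" by (rule borel_measurable_integrable)
  have le: "(\<integral>\<^sup>+w. ennreal ((norm (w t))\<^sup>2) \<partial>P) \<le> ennreal (\<sigma>\<^sup>2)"
    using assms by (auto simp: noise_laws_def)
  then show int2: "integrable P (\<lambda>w. (norm (w t))\<^sup>2)"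
    by (intro integrableI_nonneg) (simp_all add: le_less_trans[OF le])
  show "(\<integral>w. (norm (w t))\<^sup>2 \<partial>P) \<le> \<sigma>\<^sup>2"
    using le by (subst (asm) nn_integral_eq_integral[OF int2]) auto
qed

text \<open>Coordinatewise, independence makes the expectation of the product the product of
  expectations, whose factor from \<open>w s\<close> is 0.\<close>

lemma noise_cross_uncorrelated:
  fixes P :: "(nat \<Rightarrow> real^'d^1) measure" and M :: "real^'d^1 \<Rightarrow> real^'d^1"
  assumes P: "P \<in> noise_laws \<sigma>" and M: "linear M" and st: "s \<noteq> t"
  shows "integrable P (\<lambda>w. w s \<bullet> M (w t)) \<and> (\<integral>w. w s \<bullet> M (w t) \<partial>P) = 0"
proof -
  interpret prob_space P by (rule noise_lawsD[OF P])
  have bl: "bounded_linear M" using M by (rule linear_conv_bounded_linear[THEN iffD1])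
  have "integrable P (\<lambda>w. (w s \<bullet> i) * (M (w t) \<bullet> i)) \<and> (\<integral>w. (w s \<bullet> i) * (M (w t) \<bullet> i) \<partial>P) = 0"
    for i :: "real^'d^1"
  proof -
    let ?Y = "\<lambda>k v. if k = s then v \<bullet> i else M v \<bullet> i"
    have [measurable]: "M \<in> borel_measurable borel"
      by (rule borel_measurable_continuous_onI[OF linear_continuous_on[OF bl]])
    have "indep_vars (\<lambda>_. borel) (\<lambda>k w. w k) UNIV"
      using P by (simp add: noise_laws_def)
    then have "indep_vars (\<lambda>_. borel) (\<lambda>k w. w k) {s, t}"
      by (rule indep_vars_subset) simp
    then have ind: "indep_vars (\<lambda>_. borel) (\<lambda>k w. ?Y k (w k)) {s, t}"
      by (rule indep_vars_compose2) auto
    have int: "integrable P (\<lambda>w. ?Y k (w k))" if "k \<in> {s, t}" for k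
    proof -
      have "integrable P (\<lambda>w. w k \<bullet> i)" "integrable P (\<lambda>w. M (w k) \<bullet> i)"
        using noise_lawsD(3)[OF P, of k] integrable_bounded_linear[OF bl noise_lawsD(3)[OF P, of k]]
        by (simp_all add: integrable_inner_left)
      then show ?thesis by (cases "k = s") simp_all
    qed
    have "(\<integral>w. w s \<bullet> i \<partial>P) = 0"
      using noise_lawsD(3,4)[OF P, of s] by (simp add: integral_inner_left)
    then show ?thesis
      using indep_vars_integrable[OF _ ind int] indep_vars_lebesgue_integral[OF _ ind int] st
      by auto
  qed
  moreover have "(\<lambda>w. w s \<bullet> M (w t)) = (\<lambda>w. \<Sum>i\<in>Basis. (w s \<bullet> i) * (M (w t) \<bullet> i))"
    by (rule ext) (rule euclidean_inner)
  ultimately show ?thesis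
    by (simp add: integrable_sum[where I = Basis] integral_sum[where I = Basis])
qed

text \<open>Entries up to \<open>Suc s\<close> involve only noise before time s. Quantifying over
  all linear \<open>M\<close> lets the induction absorb \<open>G\<close> into \<open>M\<close>, so
  independence is needed only for pairs of noise terms.\<close>

lemma noise_traj_uncorrelated:
  fixes P :: "(nat \<Rightarrow> real^'d^1) measure" and M :: "real^'d^1 \<Rightarrow> real^'d^1"
  assumes P: "P \<in> noise_laws \<sigma>" and G: "linear G" and M: "linear M" and st: "t \<le> Suc s"
  shows "integrable P (\<lambda>w. w s \<bullet> M (traj G a b x0 x1 w t)) \<and>
    (\<integral>w. w s \<bullet> M (traj G a b x0 x1 w t) \<partial>P) = 0"
  using M st
proof (induction t arbitrary: M rule: induct_nat_012)
  case 0
  then show ?case using noise_lawsD(3,4)[OF P, of s] by (simp add: integral_inner_left)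
next
  case 1
  then show ?case using noise_lawsD(3,4)[OF P, of s] by (simp add: integral_inner_left)
next
  case (ge2 t)
  let ?x = "traj G a b x0 x1"
  interpret M: linear M by (rule ge2.prems)
  have "linear (\<lambda>v. M (G v))" using linear_compose[OF G ge2.prems(1)] by (simp add: o_def)
  then have 1: "integrable P (\<lambda>w. w s \<bullet> M (G (?x w (Suc t)))) \<and> (\<integral>w. w s \<bullet> M (G (?x w (Suc t))) \<partial>P) = 0"
    by (rule ge2.IH(2)) (use ge2.prems in simp)
  have 2: "integrable P (\<lambda>w. w s \<bullet> M (?x w t)) \<and> (\<integral>w. w s \<bullet> M (?x w t) \<partial>P) = 0"
    by (rule ge2.IH(1)) (use ge2.prems in simp_all)
  have 3: "integrable P (\<lambda>w. w s \<bullet> M (w t)) \<and> (\<integral>w. w s \<bullet> M (w t) \<partial>P) = 0"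
    using ge2.prems by (intro noise_cross_uncorrelated[OF P]) auto
  have "w s \<bullet> M (?x w (Suc (Suc t))) = w s \<bullet> M (G (?x w (Suc t))) - b * (w s \<bullet> M (?x w t)) - a * (w s \<bullet> M (w t))" for w
    by (simp add: M.diff M.scale inner_diff_right)
  with 1 2 3 show ?case by simp
qed

text \<open>Independent random signs times \<open>e\<close> have mean zero and almost surely the
  full length \<sigma> at every time. The noise power is thus attained, and the paths obey the
  uniform bound of \<open>scalar_traj_bounded\<close>.\<close>

lemma rademacher_noise:
  fixes e :: "real^'d^1"
  assumes e: "norm e = \<sigma>" "0 < \<sigma>"
  obtains P :: "(nat \<Rightarrow> real^'d^1) measure" where "P \<in> noise_laws \<sigma>" "AE w in P. \<forall>t. norm (w t) = \<sigma>"
proof -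
  define N :: "(real^'d^1) measure" where "N = distr (measure_pmf (pmf_of_set {e, - e})) borel (\<lambda>x. x)"
  define P :: "(nat \<Rightarrow> real^'d^1) measure" where "P = PiM UNIV (\<lambda>_. N)"
  have "e \<noteq> - e"
  proof
    assume "e = - e"
    then have "2 *\<^sub>R e = 0" by (simp add: scaleR_2 eq_neg_iff_add_eq_0)
    then show False using e by auto
  qed
  then have card: "card {e, - e} = 2" by simp
  have N: "prob_space N" unfolding N_def by (rule measure_pmf.prob_space_distr) simp
  interpret N: prob_space N by (rule N)
  have setsN[measurable_cong, simp]: "sets N = sets borel" by (simp add: N_def)
  have normN: "AE v in N. norm v = \<sigma>"
    unfolding N_def by (subst AE_distr_iff) (auto simp: AE_measure_pmf_iff e)
  have intN: "integrable N (\<lambda>v. v)"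
    by (rule N.integrable_const_bound[of _ \<sigma>]) (use normN in \<open>auto simp: N_def\<close>)
  have meanN: "(\<integral>v. v \<partial>N) = 0"
  proof -
    have "(\<integral>v. v \<partial>N) = (\<integral>v. v \<partial>measure_pmf (pmf_of_set {e, - e}))"
      unfolding N_def by (rule integral_distr) simp_all
    also have "\<dots> = (\<Sum>v\<in>{e, - e}. pmf (pmf_of_set {e, - e}) v *\<^sub>R v)"
      by (rule integral_measure_pmf) simp_all
    also have "\<dots> = 0" using \<open>e \<noteq> - e\<close> by simp
    finally show ?thesis .
  qed
  interpret P: prob_space P unfolding P_def by (rule prob_space_PiM) (rule N)
  have setsP: "sets P = sets (\<Pi>\<^sub>M t\<in>UNIV. borel)"
    unfolding P_def by (rule sets_PiM_cong) simp_all
  have distr: "distr P borel (\<lambda>w. w t) = N" for t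
  proof -
    have "distr P borel (\<lambda>w. w t) = distr P N (\<lambda>w. w t)" by (rule distr_cong) simp_all
    also have "\<dots> = N" unfolding P_def by (rule distr_PiM_component) (use N in auto)
    finally show ?thesis .
  qed
  have meas[measurable]: "(\<lambda>w. w t) \<in> borel_measurable P" for t
    unfolding measurable_cong_sets[OF setsP refl] by (rule measurable_component_singleton) simp
  have "P.indep_vars (\<lambda>_. borel) (\<lambda>t w. w t) UNIV"
  \<comment> \<open>Independence means that the joint law is the product of the marginals; here the
    joint map is the identity on a product measure.\<close>
  proof (subst P.indep_vars_iff_distr_eq_PiM')
    have "distr P (PiM UNIV (\<lambda>_. borel)) (\<lambda>w. \<lambda>t\<in>UNIV. w t) = P"
      using setsP by (simp add: restrict_def distr_id2)
    then show "distr P (PiM UNIV (\<lambda>_. borel)) (\<lambda>w. \<lambda>t\<in>UNIV. w t) = (\<Pi>\<^sub>M t\<in>UNIV. distr P borel (\<lambda>w. w t))"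
      by (simp add: distr) (simp add: P_def)
  qed auto
  moreover have AE: "AE w in P. norm (w t) = \<sigma>" for t
    unfolding P_def using N normN by (intro AE_PiM_component) auto
  moreover have "integrable P (\<lambda>w. w t)" for t
    using intN integrable_distr[OF meas[of t], of "\<lambda>v. v"] by (simp add: distr)
  moreover have "(\<integral>w. w t \<partial>P) = 0" for t
    using meanN integral_distr[OF meas[of t], of "\<lambda>v. v"] by (simp add: distr)
  moreover have "(\<integral>\<^sup>+w. ennreal ((norm (w t))\<^sup>2) \<partial>P) \<le> ennreal (\<sigma>\<^sup>2)" for t
  proof -
    have "(\<integral>\<^sup>+w. ennreal ((norm (w t))\<^sup>2) \<partial>P) = (\<integral>\<^sup>+w. ennreal (\<sigma>\<^sup>2) \<partial>P)"
      by (rule nn_integral_cong_AE) (use AE[of t] in auto)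
    then show ?thesis by (simp add: P.emeasure_space_1)
  qed
  ultimately have "P \<in> noise_laws \<sigma>"
    using setsP P.prob_space_axioms by (simp add: noise_laws_def)
  moreover have "AE w in P. \<forall>t. norm (w t) = \<sigma>"
    using AE by (simp add: AE_all_countable)
  ultimately show ?thesis by (rule that)
qed


section \<open>Rate and sensitivity\<close>

text \<open>Substituting the hypothesis, the multiples of \<open>y - z\<close> outside
  \<open>G\<close> cancel and the step becomes that of \<open>traj\<close>. With \<eta> = 0 the
  gradient is taken at the current iterate.\<close>

lemma state_heavy_ball:
  assumes "\<And>y. a *\<^sub>R gradient f y = (1 + b) *\<^sub>R (y - z) - G (y - z)"
  shows "state (three_param a b 0) f w (stack x1 x0) t =
    stack (z + traj G a b (x0 - z) (x1 - z) w (Suc t)) (z + traj G a b (x0 - z) (x1 - z) w t)"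
proof (induction t)
  case 0
  show ?case by simp
next
  case (Suc t)
  show ?case
    unfolding three_param_step(1)[OF Suc.IH]
    by (simp add: scaleR_add_right assms algebra_simps)
qed

lemma stack_cases:
  obtains x1 x0 where "\<xi> = stack x1 x0"
proof
  show "\<xi> = stack (\<chi> _. \<xi> $ 1) (\<chi> _. \<xi> $ 2)"
    by (simp add: stack_def vec_eq_iff forall_2)
qed

lemma norm_stack_diff:
  "norm (stack x1 x0 - stack z1 z0) = sqrt ((norm (x1 - z1))\<^sup>2 + (norm (x0 - z0))\<^sup>2)"
proof -
  have "(norm (stack x1 x0 - stack z1 z0))\<^sup>2 = (norm (x1 - z1))\<^sup>2 + (norm (x0 - z0))\<^sup>2"
    by (simp add: power2_norm_eq_inner inner_vec_def sum_2 stack_def)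
  then show ?thesis by (metis norm_ge_zero real_sqrt_unique)
qed

lemma norm_stack_diff_le: "norm (stack x1 x0 - stack z1 z0) \<le> norm (x1 - z1) + norm (x0 - z0)"
  unfolding norm_stack_diff by (rule sqrt_sum_squares_le_sum) simp_all

lemma norm_stack_diff_ge: "norm (x1 - z1) + norm (x0 - z0) \<le> 2 * norm (stack x1 x0 - stack z1 z0)"
  using real_sqrt_sum_squares_ge1[of "norm (x1 - z1)" "norm (x0 - z0)"]
    real_sqrt_sum_squares_ge2[of "norm (x0 - z0)" "norm (x1 - z1)"]
  unfolding norm_stack_diff by linarith

text \<open>For negative x both sides are 0, because the real \<open>sqrt\<close> is then negative.
  This matters for lower bounds that are negative for small T.\<close>

lemma sqrt_ennreal_ennreal: "sqrt_ennreal (ennreal x) = ennreal (sqrt x)"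
  by (cases "0 \<le> x") (simp_all add: sqrt_ennreal_def ennreal_neg)

lemma sqrt_ennreal_mono: "x \<le> y \<Longrightarrow> sqrt_ennreal x \<le> sqrt_ennreal y"
  by (cases x; cases y) (auto simp: sqrt_ennreal_ennreal sqrt_ennreal_def[of top] top_unique)

text \<open>The constant c stands for boundary energies independent of T, which averaging removes:
  the initial one in the upper bound, the bound on the final one in the lower.\<close>

lemma averaged_tendsto:
  fixes \<sigma> c k q :: real
  assumes "0 < \<sigma>"
  shows "(\<lambda>T. ennreal (sqrt (1 / (\<sigma>\<^sup>2 * real T) * ((c + k * \<sigma>\<^sup>2 * real T) / q)))) \<longlonglongrightarrow>
    ennreal (sqrt (k / q))"
proof (intro tendsto_ennrealI tendsto_real_sqrt)
  have "(\<lambda>T. (c / (\<sigma>\<^sup>2 * q)) * (1 / real T) + k / q) \<longlonglongrightarrow> (c / (\<sigma>\<^sup>2 * q)) * 0 + k / q"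
    by (intro tendsto_intros lim_1_over_n)
  moreover have "\<forall>\<^sub>F T in sequentially. (c / (\<sigma>\<^sup>2 * q)) * (1 / real T) + k / q =
      1 / (\<sigma>\<^sup>2 * real T) * ((c + k * \<sigma>\<^sup>2 * real T) / q)"
    using eventually_gt_at_top[of 0]
  proof eventually_elim
    case (elim T)
    then show ?case using assms by (cases "q = 0") (simp_all add: field_simps)
  qed
  ultimately show "(\<lambda>T. 1 / (\<sigma>\<^sup>2 * real T) * ((c + k * \<sigma>\<^sup>2 * real T) / q)) \<longlonglongrightarrow> k / q"
    by (simp add: tendsto_cong)
qed

text \<open>\<open>ennreal\<close> truncates at 0, which can only increase the integral. The
  integrand may be negative, as the pathwise lower bound for the outputs can be.\<close>

lemma ennreal_integral_le_nn_integral: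
  assumes "integrable M f"
  shows "ennreal (integral\<^sup>L M f) \<le> (\<integral>\<^sup>+x. ennreal (f x) \<partial>M)"
proof -
  have "integral\<^sup>L M f \<le> (\<integral>x. max 0 (f x) \<partial>M)"
    using assms by (intro integral_mono) auto
  then have "ennreal (integral\<^sup>L M f) \<le> (\<integral>\<^sup>+x. ennreal (max 0 (f x)) \<partial>M)"
    using assms by (subst nn_integral_eq_integral) (auto intro: ennreal_leI)
  moreover have "ennreal (max 0 (f x)) = ennreal (f x)" for x by (simp add: max_def ennreal_neg)
  ultimately show ?thesis by simp
qed

section \<open>Expected sums of squared outputs\<close>

lemma expected_cross_sum:
  fixes P :: "(nat \<Rightarrow> real^'d^1) measure" and a b c :: real and x0 x1 :: "real^'d^1"
  assumes P: "P \<in> noise_laws \<sigma>" and G: "linear G"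
  defines "S \<equiv> \<lambda>T w. \<Sum>t<T. w t \<bullet> (G (traj G a b x0 x1 w (Suc t)) - c *\<^sub>R traj G a b x0 x1 w t)"
  shows "integrable P (S T) \<and> (\<integral>w. S T w \<partial>P) = 0"
proof -
  have "integrable P (\<lambda>w. w t \<bullet> G (traj G a b x0 x1 w (Suc t)))"
    "(\<integral>w. w t \<bullet> G (traj G a b x0 x1 w (Suc t)) \<partial>P) = 0" for t
    using noise_traj_uncorrelated[OF P G G] by simp_all
  moreover have "integrable P (\<lambda>w. w t \<bullet> traj G a b x0 x1 w t)"
    "(\<integral>w. w t \<bullet> traj G a b x0 x1 w t \<partial>P) = 0" for t
    using noise_traj_uncorrelated[OF P G linear_ident, of t t] by simp_all
  ultimately show ?thesis
    unfolding S_def inner_diff_right by simp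
qed

lemma expected_output_sum_le:
  fixes P :: "(nat \<Rightarrow> real^'d^1) measure" and r :: real
  assumes P: "P \<in> noise_laws \<sigma>" and lin: "linear G" and sym: "\<And>x y. G x \<bullet> y = x \<bullet> G y"
    and bound: "\<And>x. norm (G x) \<le> 2 * r * norm x" and r: "0 \<le> r" "r < 1" and c: "0 \<le> c"
  defines "b \<equiv> r\<^sup>2"
  shows "(\<integral>\<^sup>+w. ennreal (c * (\<Sum>t<T. (norm (traj G a b x0 x1 w (Suc t)))\<^sup>2)) \<partial>P) \<le>
    ennreal (c * ((energy G b x0 x1 + a\<^sup>2 * (1 + b) * \<sigma>\<^sup>2 * real T) / (1 - b) ^ 3))"
proof -
  let ?S = "\<lambda>w. \<Sum>t<T. w t \<bullet> (G (traj G a b x0 x1 w (Suc t)) - (b * (1 + b)) *\<^sub>R traj G a b x0 x1 w t)"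
  let ?B = "\<lambda>w. c * ((energy G b x0 x1 + a\<^sup>2 * (1 + b) * (\<Sum>t<T. (norm (w t))\<^sup>2) - 2 * a * ?S w) / (1 - b) ^ 3)"
  interpret prob_space P by (rule noise_lawsD[OF P])
  have b: "0 < (1 - b) ^ 3" "0 \<le> b" using r by (simp_all add: b_def power_less_one_iff)
  have le: "c * (\<Sum>t<T. (norm (traj G a b x0 x1 w (Suc t)))\<^sup>2) \<le> ?B w" for w
    using traj_output_sum_le[OF sym bound r, of a x0 x1 w T] b
    by (intro mult_left_mono[OF _ c]) (simp add: b_def pos_le_divide_eq mult.commute)
  \<comment> \<open>The majorant inherits its sign from the sum of squares below it, so its
    nonnegative integral is the ordinary one and the cross terms vanish by linearity.\<close>
  have nonneg: "0 \<le> ?B w" for w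
    by (rule order_trans[OF _ le]) (simp add: c sum_nonneg)
  note S = expected_cross_sum[OF P lin, of a b x0 x1 "b * (1 + b)" T]
  have int: "integrable P ?B"
    using S noise_lawsD(5)[OF P] by (intro integrable_mult_right integrable_divide integrable_diff
      integrable_add integrable_const integrable_sum) simp_all
  have "(\<integral>\<^sup>+w. ennreal (c * (\<Sum>t<T. (norm (traj G a b x0 x1 w (Suc t)))\<^sup>2)) \<partial>P) \<le> (\<integral>\<^sup>+w. ennreal (?B w) \<partial>P)"
    by (intro nn_integral_mono ennreal_leI le)
  also have "\<dots> = ennreal (\<integral>w. ?B w \<partial>P)"
    by (rule nn_integral_eq_integral[OF int AE_I2]) (rule nonneg)
  also have "(\<integral>w. ?B w \<partial>P) =
      c * ((energy G b x0 x1 + a\<^sup>2 * (1 + b) * (\<Sum>t<T. \<integral>w. (norm (w t))\<^sup>2 \<partial>P)) / (1 - b) ^ 3)"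
    using S noise_lawsD(5)[OF P] by (simp add: prob_space)
  also have "\<dots> \<le> c * ((energy G b x0 x1 + a\<^sup>2 * (1 + b) * (\<sigma>\<^sup>2 * real T)) / (1 - b) ^ 3)"
  proof -
    have "(\<Sum>t<T. \<integral>w. (norm (w t))\<^sup>2 \<partial>P) \<le> (\<Sum>t<T. \<sigma>\<^sup>2)"
      by (intro sum_mono noise_lawsD(6)[OF P])
    then show ?thesis
      using b c by (intro mult_left_mono divide_right_mono add_left_mono) (simp_all add: mult.commute)
  qed
  finally show ?thesis by (simp add: ennreal_leI mult.assoc)
qed

lemma expected_scalar_output_sum_ge:
  fixes P :: "(nat \<Rightarrow> real^'d^1) measure" and r :: real
  assumes P: "P \<in> noise_laws \<sigma>" and norm: "AE w in P. \<forall>t. norm (w t) = \<sigma>"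
    and r: "0 \<le> r" "r < 1" and c: "0 \<le> c"
  defines "b \<equiv> r\<^sup>2"
  shows "ennreal (c * ((- 8 * (\<bar>a\<bar> * \<sigma> / (1 - r)\<^sup>2)\<^sup>2 + a\<^sup>2 * (1 + b) * \<sigma>\<^sup>2 * real T) / (1 - b) ^ 3)) \<le>
    (\<integral>\<^sup>+w. ennreal (c * (\<Sum>t<T. (norm (traj (\<lambda>v. (2 * r) *\<^sub>R v) a b 0 0 w (Suc t)))\<^sup>2)) \<partial>P)"
proof -
  let ?x = "traj (\<lambda>v::real^'d^1. (2 * r) *\<^sub>R v) a b 0 0"
  let ?S = "\<lambda>w. \<Sum>t<T. w t \<bullet> ((2 * r) *\<^sub>R ?x w (Suc t) - (b * (1 + b)) *\<^sub>R ?x w t)"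
  define E where "E = - 8 * (\<bar>a\<bar> * \<sigma> / (1 - r)\<^sup>2)\<^sup>2 + a\<^sup>2 * (1 + b) * \<sigma>\<^sup>2 * real T"
  let ?B = "\<lambda>w. c * ((E - 2 * a * ?S w) / (1 - b) ^ 3)"
  interpret prob_space P by (rule noise_lawsD[OF P])
  have b: "0 < (1 - b) ^ 3" using r by (simp add: b_def power_less_one_iff)
  have le: "?B w \<le> c * (\<Sum>t<T. (norm (?x w (Suc t)))\<^sup>2)" if "\<forall>t. norm (w t) = \<sigma>" for w
    using scalar_traj_output_sum_ge[OF r, of w \<sigma> a T] that b
    by (intro mult_left_mono[OF _ c]) (simp add: b_def E_def pos_divide_le_eq mult.commute)
  note S = expected_cross_sum[OF P linear_scaleR[of "2 * r"], of a b 0 0 "b * (1 + b)" T]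
  have int: "integrable P ?B"
    using S by (intro integrable_mult_right integrable_divide integrable_diff integrable_const) simp_all
  have "(\<integral>w. ?B w \<partial>P) = c * (E / (1 - b) ^ 3)"
    using S by (simp add: prob_space)
  then have "ennreal (c * (E / (1 - b) ^ 3)) \<le> (\<integral>\<^sup>+w. ennreal (?B w) \<partial>P)"
    using ennreal_integral_le_nn_integral[OF int] by (simp only:)
  also have "\<dots> \<le> (\<integral>\<^sup>+w. ennreal (c * (\<Sum>t<T. (norm (?x w (Suc t)))\<^sup>2)) \<partial>P)"
    by (rule nn_integral_mono_AE) (use norm in eventually_elim, intro ennreal_leI le)
  finally show ?thesis by (simp add: E_def)
qed

context
  fixes m L r :: real
  assumes m: "0 < m" "m \<le> L"
    and r: "(sqrt L - sqrt m) / (sqrt L + sqrt m) \<le> r" "r < 1"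
begin

abbreviation (input) step_size :: real where "step_size \<equiv> 1 / m * (1 - r)\<^sup>2"

abbreviation (input) heavy_ball :: "2 algorithm" where
  "heavy_ball \<equiv> three_param step_size (r\<^sup>2) 0"

lemma r_nonneg: "0 \<le> r"
proof -
  have "0 \<le> (sqrt L - sqrt m) / (sqrt L + sqrt m)" using m by simp
  then show ?thesis using r by linarith
qed

lemma quad_class_heavy_ball:
  fixes f :: "real^'d^1 \<Rightarrow> real"
  assumes "f \<in> quad_class m L"
  obtains G z where "linear G" "\<forall>x y. G x \<bullet> y = x \<bullet> G y" "\<forall>v. norm (G v) \<le> 2 * r * norm v"
    "minimizer f = z" "\<forall>y. step_size *\<^sub>R gradient f y = (1 + r\<^sup>2) *\<^sub>R (y - z) - G (y - z)"
proof -
  obtain fstar z Q where Q: "transpose Q = Q" "\<forall>c. is_eigenvalue Q c \<longrightarrow> c \<in> {m..L}"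
    "\<And>y. f y = 1/2 * ((y - z) ** Q ** transpose (y - z)) $ 1 $ 1 + fstar"
    using assms unfolding quad_class_def by blast
  note h = quadratic_heavy_ball_operator[OF m r Q]
  show ?thesis
    by (rule that[OF h(1) _ _ h(4)]) (intro allI h)+
qed

lemma scalar_heavy_ball:
  obtains f :: "real^'d^1 \<Rightarrow> real" where "f \<in> quad_class m L" "minimizer f = 0"
    "\<forall>y. step_size *\<^sub>R gradient f y = (1 + r\<^sup>2) *\<^sub>R (y - 0) - (2 * r) *\<^sub>R (y - 0)"
proof
  let ?f = "\<lambda>y::real^'d^1. 1/2 * ((y - 0) ** mat m ** transpose (y - 0)) $ 1 $ 1 + 0"
  note q = scalar_quadratic_in_quad_class[OF m(2)]
  note h = quadratic_heavy_ball_operator[OF m r transpose_mat q(2), where f = ?f and ystar = 0 and fstar = 0]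
  show "?f \<in> quad_class m L" by (rule q(1))
  show "minimizer ?f = 0" by (rule h(4)) simp_all
  have grad: "step_size *\<^sub>R gradient ?f y = (1 + r\<^sup>2) *\<^sub>R (y - 0)
      - ((1 + r\<^sup>2) *\<^sub>R (y - 0) - step_size *\<^sub>R ((y - 0) ** mat m))" for y
    by (rule h(5)) simp_all
  \<comment> \<open>The choice of step size enters through 1 + r^2 - (1 - r)^2 = 2 r.\<close>
  have G: "(1 + r\<^sup>2) *\<^sub>R y - step_size *\<^sub>R (y ** mat m) = (2 * r) *\<^sub>R y" for y :: "real^'d^1"
    using m by (simp add: q(3) power2_diff flip: scaleR_left_diff_distrib)
  show "\<forall>y. step_size *\<^sub>R gradient ?f y = (1 + r\<^sup>2) *\<^sub>R (y - 0) - (2 * r) *\<^sub>R (y - 0)"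
    by (simp only: grad G simp_thms)
qed

section \<open>The convergence rate\<close>

lemma state_error_bound:
  fixes f :: "real^'d^1 \<Rightarrow> real"
  assumes f: "f \<in> quad_class m L" and \<rho>: "r < \<rho>"
  shows "norm (state heavy_ball f (\<lambda>_. 0) \<xi> t - fixed_point heavy_ball f) \<le>
    2 * (1 + 1 / (\<rho> - r)) * (1 + \<rho>) * (\<rho> ^ t * norm (\<xi> - fixed_point heavy_ball f))"
proof -
  obtain x1 x0 where \<xi>: "\<xi> = stack x1 x0" by (rule stack_cases)
  obtain G z where *: "linear G" "\<forall>x y. G x \<bullet> y = x \<bullet> G y" "\<forall>v. norm (G v) \<le> 2 * r * norm v"
    "minimizer f = z" "\<forall>y. step_size *\<^sub>R gradient f y = (1 + r\<^sup>2) *\<^sub>R (y - z) - G (y - z)"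
    by (rule quad_class_heavy_ball[OF f])
  note G = *(1) *(2,3)[rule_format] and z = *(4) *(5)[rule_format]
  define D where "D = 1 + 1 / (\<rho> - r)"
  define N where "N = norm (x1 - z) + norm (x0 - z)"
  let ?x = "traj G step_size (r\<^sup>2) (x0 - z) (x1 - z) (\<lambda>_. 0)"
  have x: "norm (?x t) \<le> D * \<rho> ^ t * N" for t
    using traj_geometric_bound[OF G(2,3) r_nonneg r(2) \<rho>, of step_size "x0 - z" "x1 - z" t]
    by (simp add: D_def N_def add.commute)
  have "norm (state heavy_ball f (\<lambda>_. 0) \<xi> t - fixed_point heavy_ball f) \<le> norm (?x (Suc t)) + norm (?x t)"
    unfolding \<xi> state_heavy_ball[OF z(2)] fixed_point_three_param z(1)
    by (rule order_trans[OF norm_stack_diff_le]) simp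
  also have "\<dots> \<le> D * \<rho> ^ Suc t * N + D * \<rho> ^ t * N" by (intro add_mono x)
  also have "\<dots> = D * (1 + \<rho>) * \<rho> ^ t * N" by (simp add: algebra_simps)
  \<comment> \<open>The factor 1 + \<rho> collects the two consecutive errors in a state; the new
    factor 2 compares the sum of their initial norms with the Frobenius norm.\<close>
  also have "\<dots> \<le> D * (1 + \<rho>) * \<rho> ^ t * (2 * norm (\<xi> - fixed_point heavy_ball f))"
    unfolding \<xi> fixed_point_three_param z(1) N_def
    using r_nonneg \<rho> by (intro mult_left_mono norm_stack_diff_ge) (simp add: D_def)
  finally show ?thesis by (simp only: D_def mult_ac)
qed

lemma rate_le: "rate heavy_ball (quad_class m L :: (real^'d^1 \<Rightarrow> real) set) \<le> ennreal r"
\<comment> \<open>Only exponents strictly above r are tested: at r itself a double root can make the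
  quotient grow linearly in t.\<close>
proof (rule ennreal_le_epsilon)
  fix e :: real
  assume "0 < e"
  define \<rho> where "\<rho> = r + e"
  define K where "K = 2 * (1 + 1 / (\<rho> - r)) * (1 + \<rho>)"
  have \<rho>: "r < \<rho>" "0 < \<rho>" using \<open>0 < e\<close> r_nonneg by (simp_all add: \<rho>_def)
  have K: "0 \<le> K" using \<rho> by (simp add: K_def)
  let ?q = "\<lambda>(f :: real^'d^1 \<Rightarrow> real) \<xi> t. ennreal (norm (state heavy_ball f (\<lambda>_. 0) \<xi> t - fixed_point heavy_ball f)
                 / (\<rho> ^ t * norm (\<xi> - fixed_point heavy_ball f)))"
  have "?q f \<xi> t \<le> ennreal K" if "f \<in> quad_class m L" for f \<xi> t
  proof (cases "\<xi> = fixed_point heavy_ball f")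
    case True
    \<comment> \<open>The denominator is 0 here, so the quotient is 0.\<close>
    then show ?thesis using K by simp
  next
    case False
    then show ?thesis
      using \<rho> state_error_bound[OF that \<rho>(1), of \<xi> t] by (intro ennreal_leI) (simp add: pos_divide_le_eq K_def)
  qed
  then have "(SUP f\<in>quad_class m L. SUP \<xi>. SUP t. ?q f \<xi> t) \<le> ennreal K"
    by (intro SUP_least)
  then have "(SUP f\<in>quad_class m L. SUP \<xi>. SUP t. ?q f \<xi> t) < \<infinity>"
    by (rule le_less_trans) simp
  then have "rate heavy_ball (quad_class m L :: (real^'d^1 \<Rightarrow> real) set) \<le> ennreal \<rho>"
    unfolding rate_def using \<rho> by (intro INF_lower) simp
  then show "rate heavy_ball (quad_class m L :: (real^'d^1 \<Rightarrow> real) set) \<le> ennreal r + ennreal e"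
    using r_nonneg \<open>0 < e\<close> by (simp add: \<rho>_def)
qed

text \<open>
  For \<open>Q = m I\<close> both characteristic roots equal \<open>r\<close>, so that \<open>x\<^sup>t = r\<^sup>t e\<close> is a trajectory.
\<close>

lemma rate_ge: "ennreal r \<le> rate heavy_ball (quad_class m L :: (real^'d^1 \<Rightarrow> real) set)"
  unfolding rate_def
proof (rule INF_greatest, clarify)
  fix \<rho> :: real
  let ?q = "\<lambda>(f :: real^'d^1 \<Rightarrow> real) \<xi> t. ennreal (norm (state heavy_ball f (\<lambda>_. 0) \<xi> t - fixed_point heavy_ball f)
                 / (\<rho> ^ t * norm (\<xi> - fixed_point heavy_ball f)))"
  assume \<rho>: "0 < \<rho>" and fin: "(SUP f\<in>quad_class m L. SUP \<xi>. SUP t. ?q f \<xi> t) < \<infinity>"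
  show "ennreal r \<le> ennreal \<rho>"
  proof (rule ccontr)
    assume "\<not> ennreal r \<le> ennreal \<rho>"
    then have "\<rho> < r" using ennreal_leI by (meson not_less)
    obtain f :: "real^'d^1 \<Rightarrow> real" where f: "f \<in> quad_class m L" and min: "minimizer f = 0"
      and grad: "\<forall>y. step_size *\<^sub>R gradient f y = (1 + r\<^sup>2) *\<^sub>R (y - 0) - (2 * r) *\<^sub>R (y - 0)"
      by (rule scalar_heavy_ball)
    note z = min grad[rule_format]
    obtain e :: "real^'d^1" where e: "norm e = 1"
      using vector_choose_size[of 1] by auto
    have x: "traj (\<lambda>v. (2 * r) *\<^sub>R v) step_size (r\<^sup>2) e (r *\<^sub>R e) (\<lambda>_. 0) t = r ^ t *\<^sub>R e" for t
    proof (induction t rule: induct_nat_012)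
      case (ge2 t)
      have "(2 * r) *\<^sub>R (r ^ Suc t *\<^sub>R e) - r\<^sup>2 *\<^sub>R (r ^ t *\<^sub>R e) = r ^ Suc (Suc t) *\<^sub>R e"
        by (simp add: power2_eq_square mult_ac flip: scaleR_left_diff_distrib)
      then show ?case unfolding traj.simps(3) ge2 by simp
    qed simp_all
    let ?\<xi> = "stack (r *\<^sub>R e) e"
    have "?\<xi> \<noteq> stack 0 0"
      using norm_stack_diff[of "r *\<^sub>R e" e 0 0] e by (auto simp: add_nonneg_eq_0_iff)
    moreover have "norm (state heavy_ball f (\<lambda>_. 0) ?\<xi> t - stack 0 0) = r ^ t * norm (?\<xi> - stack 0 0)" for t
    proof -
      have "state heavy_ball f (\<lambda>_. 0) ?\<xi> t = stack (r ^ Suc t *\<^sub>R e) (r ^ t *\<^sub>R e)"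
        using state_heavy_ball[OF z(2), of "\<lambda>_. 0" "r *\<^sub>R e" e t] by (simp only: x add_0 diff_zero)
      moreover have "stack (r ^ Suc t *\<^sub>R e) (r ^ t *\<^sub>R e) - stack 0 0 = r ^ t *\<^sub>R (?\<xi> - stack 0 0)"
        by (simp add: stack_def vec_eq_iff forall_2)
      ultimately show ?thesis using r_nonneg by simp
    qed
    ultimately have q: "?q f ?\<xi> t = ennreal ((r / \<rho>) ^ t)" for t
      by (simp add: fixed_point_three_param z(1) power_divide)
    have "?q f ?\<xi> t \<le> (SUP f\<in>quad_class m L. SUP \<xi>. SUP t. ?q f \<xi> t)" for t
      by (rule SUP_upper2[OF f], rule SUP_upper2[of ?\<xi>], simp, rule SUP_upper) simp
    then have le: "ennreal ((r / \<rho>) ^ t) \<le> (SUP f\<in>quad_class m L. SUP \<xi>. SUP t. ?q f \<xi> t)" for t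
      unfolding q .
    obtain K where K: "0 \<le> K" "(SUP f\<in>quad_class m L. SUP \<xi>. SUP t. ?q f \<xi> t) = ennreal K"
      using fin unfolding infinity_ennreal_def less_top_ennreal by (elim exE conjE) (rule that)
    obtain t where "K < (r / \<rho>) ^ t"
      using real_arch_pow[of "r / \<rho>" K] \<open>\<rho> < r\<close> \<rho> by auto
    then show False using le[of t] K by (simp add: ennreal_le_iff)
  qed
qed

section \<open>The sensitivity\<close>

lemma sens_constant:
  "step_size\<^sup>2 * (1 + r\<^sup>2) / (1 - r\<^sup>2) ^ 3 = (1 / m)\<^sup>2 * ((1 - r^4) / (1 + r)^4)"
proof -
  have "1 - r > 0" "1 + r > 0" using r r_nonneg by simp_all
  moreover have "1 - r\<^sup>2 = (1 - r) * (1 + r)" "1 - r ^ 4 = (1 - r) * (1 + r) * (1 + r\<^sup>2)"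
    by (simp_all add: algebra_simps power2_eq_square power4_eq_xxxx)
  ultimately show ?thesis
    using m by (simp add: frac_eq_eq power2_eq_square power3_eq_cube power4_eq_xxxx mult_ac)
qed

lemma output_heavy_ball:
  assumes "\<And>y. a *\<^sub>R gradient f y = (1 + b) *\<^sub>R (y - z) - G (y - z)"
  shows "alg_output (three_param a b 0) f w (stack x1 x0) t = z + traj G a b (x0 - z) (x1 - z) w (Suc t)"
  using three_param_step(2)[OF state_heavy_ball[OF assms]] by simp

lemma sens_le:
  assumes \<sigma>: "0 < \<sigma>"
  shows "sens \<sigma> heavy_ball (quad_class m L :: (real^'d^1 \<Rightarrow> real) set) \<le>
    ennreal (sqrt (step_size\<^sup>2 * (1 + r\<^sup>2) / (1 - r\<^sup>2) ^ 3))"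
  unfolding sens_def
proof (intro SUP_least)
  fix f :: "real^'d^1 \<Rightarrow> real" and \<xi> :: "real^'d^2" and P :: "(nat \<Rightarrow> real^'d^1) measure"
  assume f: "f \<in> quad_class m L" and P: "P \<in> noise_laws \<sigma>"
  obtain x1 x0 where \<xi>: "\<xi> = stack x1 x0" by (rule stack_cases)
  obtain G z where *: "linear G" "\<forall>x y. G x \<bullet> y = x \<bullet> G y" "\<forall>v. norm (G v) \<le> 2 * r * norm v"
    "minimizer f = z" "\<forall>y. step_size *\<^sub>R gradient f y = (1 + r\<^sup>2) *\<^sub>R (y - z) - G (y - z)"
    by (rule quad_class_heavy_ball[OF f])
  note G = *(1) *(2,3)[rule_format] and z = *(4) *(5)[rule_format]
  let ?E = "energy G (r\<^sup>2) (x0 - z) (x1 - z)"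
  \<comment> \<open>The bound covers T = 0 too, where 1 / 0 = 0 makes both sides vanish. The initial
    energy depends on the function and the start but not on T.\<close>
  have "sqrt_ennreal (\<integral>\<^sup>+w. ennreal (1 / (\<sigma>\<^sup>2 * real T) *
      (\<Sum>t<T. (norm (alg_output heavy_ball f w \<xi> t - minimizer f))\<^sup>2)) \<partial>P) \<le>
    ennreal (sqrt (1 / (\<sigma>\<^sup>2 * real T) *
      ((?E + step_size\<^sup>2 * (1 + r\<^sup>2) * \<sigma>\<^sup>2 * real T) / (1 - r\<^sup>2) ^ 3)))" for T
    unfolding \<xi> output_heavy_ball[OF z(2)] z(1) add_diff_cancel_left'
    unfolding sqrt_ennreal_ennreal[symmetric]
    by (intro sqrt_ennreal_mono expected_output_sum_le[OF P G r_nonneg r(2)]) simp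
  then have "limsup (\<lambda>T. sqrt_ennreal (\<integral>\<^sup>+w. ennreal (1 / (\<sigma>\<^sup>2 * real T) *
      (\<Sum>t<T. (norm (alg_output heavy_ball f w \<xi> t - minimizer f))\<^sup>2)) \<partial>P)) \<le>
    limsup (\<lambda>T. ennreal (sqrt (1 / (\<sigma>\<^sup>2 * real T) *
      ((?E + step_size\<^sup>2 * (1 + r\<^sup>2) * \<sigma>\<^sup>2 * real T) / (1 - r\<^sup>2) ^ 3))))"
    by (intro Limsup_mono always_eventually allI)
  also have "\<dots> = ennreal (sqrt (step_size\<^sup>2 * (1 + r\<^sup>2) / (1 - r\<^sup>2) ^ 3))"
    by (rule lim_imp_Limsup[OF _ averaged_tendsto[OF \<sigma>]]) simp
  finally show "limsup (\<lambda>T. sqrt_ennreal (\<integral>\<^sup>+w. ennreal (1 / (\<sigma>\<^sup>2 * real T) *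
      (\<Sum>t<T. (norm (alg_output heavy_ball f w \<xi> t - minimizer f))\<^sup>2)) \<partial>P)) \<le>
    ennreal (sqrt (step_size\<^sup>2 * (1 + r\<^sup>2) / (1 - r\<^sup>2) ^ 3))" .
qed

lemma sens_ge:
  assumes \<sigma>: "0 < \<sigma>"
  shows "ennreal (sqrt (step_size\<^sup>2 * (1 + r\<^sup>2) / (1 - r\<^sup>2) ^ 3)) \<le>
    sens \<sigma> heavy_ball (quad_class m L :: (real^'d^1 \<Rightarrow> real) set)"
proof -
  obtain f :: "real^'d^1 \<Rightarrow> real" where f: "f \<in> quad_class m L" and min: "minimizer f = 0"
    and grad: "\<forall>y. step_size *\<^sub>R gradient f y = (1 + r\<^sup>2) *\<^sub>R (y - 0) - (2 * r) *\<^sub>R (y - 0)"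
    by (rule scalar_heavy_ball)
  note z = min grad[rule_format]
  obtain e :: "real^'d^1" where e: "norm e = \<sigma>"
    using vector_choose_size[of \<sigma>] \<sigma> by auto
  obtain P :: "(nat \<Rightarrow> real^'d^1) measure" where P: "P \<in> noise_laws \<sigma>" "AE w in P. \<forall>t. norm (w t) = \<sigma>"
    by (rule rademacher_noise[OF e \<sigma>])
  \<comment> \<open>Starting at the minimizer leaves only the final energy as boundary term; this is
    the lower bound for its negative.\<close>
  let ?E = "- 8 * (\<bar>step_size\<bar> * \<sigma> / (1 - r)\<^sup>2)\<^sup>2"
  let ?l = "\<lambda>f \<xi> P. limsup (\<lambda>T. sqrt_ennreal (\<integral>\<^sup>+w. ennreal (1 / (\<sigma>\<^sup>2 * real T) *
      (\<Sum>t<T. (norm (alg_output heavy_ball f w \<xi> t - minimizer f))\<^sup>2)) \<partial>P))"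
  have "ennreal (sqrt (1 / (\<sigma>\<^sup>2 * real T) *
      ((?E + step_size\<^sup>2 * (1 + r\<^sup>2) * \<sigma>\<^sup>2 * real T) / (1 - r\<^sup>2) ^ 3))) \<le>
    sqrt_ennreal (\<integral>\<^sup>+w. ennreal (1 / (\<sigma>\<^sup>2 * real T) *
      (\<Sum>t<T. (norm (alg_output heavy_ball f w (stack 0 0) t - minimizer f))\<^sup>2)) \<partial>P)" for T
    unfolding output_heavy_ball[OF z(2)] z(1) add_0_left diff_zero
    unfolding sqrt_ennreal_ennreal[symmetric]
    by (rule sqrt_ennreal_mono, rule expected_scalar_output_sum_ge[OF P r_nonneg r(2)]) simp
  then have "limsup (\<lambda>T. ennreal (sqrt (1 / (\<sigma>\<^sup>2 * real T) *
      ((?E + step_size\<^sup>2 * (1 + r\<^sup>2) * \<sigma>\<^sup>2 * real T) / (1 - r\<^sup>2) ^ 3)))) \<le> ?l f (stack 0 0) P"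
    by (intro Limsup_mono always_eventually allI)
  moreover have "limsup (\<lambda>T. ennreal (sqrt (1 / (\<sigma>\<^sup>2 * real T) *
      ((?E + step_size\<^sup>2 * (1 + r\<^sup>2) * \<sigma>\<^sup>2 * real T) / (1 - r\<^sup>2) ^ 3)))) =
    ennreal (sqrt (step_size\<^sup>2 * (1 + r\<^sup>2) / (1 - r\<^sup>2) ^ 3))"
    by (rule lim_imp_Limsup[OF _ averaged_tendsto[OF \<sigma>]]) simp
  moreover have "?l f (stack 0 0) P \<le> sens \<sigma> heavy_ball (quad_class m L :: (real^'d^1 \<Rightarrow> real) set)"
    unfolding sens_def
    by (rule SUP_upper2[OF f], rule SUP_upper2[of "stack 0 0 :: real^'d^2"], simp, rule SUP_upper[OF P(1)])
  ultimately show ?thesis by simp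
qed

end

theorem theorem3p4:
  fixes m L r \<sigma> :: real
  assumes "0 < m" and "m \<le> L"
    and "(sqrt L - sqrt m) / (sqrt L + sqrt m) \<le> r" and "r < 1"
    and "0 < \<sigma>"
  shows "rate (three_param (1 / m * (1 - r)\<^sup>2) (r\<^sup>2) 0)
            (quad_class m L :: (real^'d^1 \<Rightarrow> real) set) = ennreal r \<and>
         sens \<sigma> (three_param (1 / m * (1 - r)\<^sup>2) (r\<^sup>2) 0)
            (quad_class m L :: (real^'d^1 \<Rightarrow> real) set) =
              ennreal (1 / m * sqrt ((1 - r^4) / (1 + r)^4))"
proof -
  note hyps = assms(1-4)
  have const: "sqrt ((1 / m * (1 - r)\<^sup>2)\<^sup>2 * (1 + r\<^sup>2) / (1 - r\<^sup>2) ^ 3) = 1 / m * sqrt ((1 - r^4) / (1 + r)^4)"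
    unfolding sens_constant[OF hyps] real_sqrt_mult using assms(1) by simp
  show ?thesis
    by (intro conjI antisym rate_le[OF hyps] rate_ge[OF hyps]
        sens_le[OF hyps assms(5), unfolded const] sens_ge[OF hyps assms(5), unfolded const])
qed

end
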